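(* There exists a constant $y_0>1$ such that $$\mathcal M_{3,1}(iy)<8\pi\qquad\text{for all } y\ge y_0 .$$
   Context: Let $\mathcal M=\{x+iy\in\mathbb C\mid -1/2\le x\le 1/2,\ y>0,\ x^2+y^2\ge1\}$. For $\omega\in\mathcal M$ let $T^2_\omega=\mathbb C/(\mathbb Z+\omega\mathbb Z)$ be the flat torus endowed with the Euclidean metric, and define $$\mathcal M_{3,1}(\omega)=\inf\{\mathcal W(f)\mid f:T^2_\omega\to\mathbb R^3\text{ is conformal}\},$$ where the infimum is over smooth conformal immersions and $\mathcal W(f)=\int_{T^2_\omega}H^2\,d\mu$, with $H$ the arithmetic mean of the two principal curvatures of $f$ and $\mu$ the area measure of the pull-back along $f$ of the Euclidean metric of $\mathbb R^3$. *)

theory Defs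
  imports "HOL-Analysis.Analysis"
begin

section \<open>Flat tori\<close>

definition moduli_domain :: "complex set" where
  "moduli_domain =
     {z. - 1 / 2 \<le> Re z \<and> Re z \<le> 1 / 2 \<and> Im z > 0 \<and> (Re z)\<^sup>2 + (Im z)\<^sup>2 \<ge> 1}"

definition lattice :: "complex \<Rightarrow> complex set" where
  "lattice \<omega> = {of_int m + of_int n * \<omega> | m n. True}"

text \<open>Maps on the torus \<open>\<complex> / (\<int> + \<omega> \<int>)\<close> are represented by their lifts to the universal
  cover, i.e. by lattice-periodic maps on \<open>\<complex>\<close>; since the covering projection is a local isometry,
  smoothness, conformality and curvature may be read off from the lift.\<close>

definition torus_map :: "complex \<Rightarrow> (complex \<Rightarrow> 'a) \<Rightarrow> bool" where
  "torus_map \<omega> f \<longleftrightarrow> (\<forall>z. \<forall>l\<in>lattice \<omega>. f (z + l) = f z)"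

definition fundamental_parallelogram :: "complex \<Rightarrow> complex set" where
  "fundamental_parallelogram \<omega> =
     {of_real s + of_real t * \<omega> | s t. s \<in> {0..<1} \<and> t \<in> {0..<1}}"

section \<open>Smooth conformal immersions\<close>

abbreviation dir_deriv :: "(complex \<Rightarrow> 'a::real_normed_vector) \<Rightarrow> complex \<Rightarrow> complex \<Rightarrow> 'a" where
  "dir_deriv f v z \<equiv> frechet_derivative f (at z) v"

primrec Ck :: "nat \<Rightarrow> (complex \<Rightarrow> 'a::real_normed_vector) \<Rightarrow> bool" where
  "Ck 0 f \<longleftrightarrow> continuous_on UNIV f"
| "Ck (Suc k) f \<longleftrightarrow> (\<forall>z. f differentiable (at z)) \<and> (\<forall>v. Ck k (dir_deriv f v))"

definition smooth :: "(complex \<Rightarrow> 'a::real_normed_vector) \<Rightarrow> bool" where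
  "smooth f \<longleftrightarrow> (\<forall>k. Ck k f)"

text \<open>The pull-back of the Euclidean metric of \<open>\<real>\<^sup>3\<close> along \<open>f\<close>, at the point \<open>z\<close>.\<close>

definition first_ff :: "(complex \<Rightarrow> real^3) \<Rightarrow> complex \<Rightarrow> complex \<Rightarrow> complex \<Rightarrow> real" where
  "first_ff f z v w = dir_deriv f v z \<bullet> dir_deriv f w z"

text \<open>\<open>v \<bullet> w\<close> is the Euclidean metric of \<open>\<complex> = \<real>\<^sup>2\<close>. Positivity of the conformal factor forces
  the differential of \<open>f\<close> to be injective.\<close>

definition conformal_immersion :: "complex \<Rightarrow> (complex \<Rightarrow> real^3) \<Rightarrow> bool" where
  "conformal_immersion \<omega> f \<longleftrightarrow>
     torus_map \<omega> f \<and> smooth f \<and> (\<forall>z. \<exists>c>0. \<forall>v w. first_ff f z v w = c * (v \<bullet> w))"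

section \<open>Mean curvature and Willmore energy\<close>

definition unit_normal :: "(complex \<Rightarrow> real^3) \<Rightarrow> complex \<Rightarrow> real^3" where
  "unit_normal f z = sgn (cross3 (dir_deriv f 1 z) (dir_deriv f \<i> z))"

definition second_ff :: "(complex \<Rightarrow> real^3) \<Rightarrow> complex \<Rightarrow> complex \<Rightarrow> complex \<Rightarrow> real" where
  "second_ff f z v w = dir_deriv (dir_deriv f v) w z \<bullet> unit_normal f z"

text \<open>The eigenvalues of the shape operator, i.e. of the second fundamental form relative to
  the first. At an umbilic point this set is a singleton and the two principal curvatures
  coincide.\<close>

definition principal_curvatures :: "(complex \<Rightarrow> real^3) \<Rightarrow> complex \<Rightarrow> real set" where
  "principal_curvatures f z =
     {\<kappa>. \<exists>v. v \<noteq> 0 \<and> (\<forall>w. second_ff f z v w = \<kappa> * first_ff f z v w)}"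

definition mean_curvature :: "(complex \<Rightarrow> real^3) \<Rightarrow> complex \<Rightarrow> real" where
  "mean_curvature f z = (Min (principal_curvatures f z) + Max (principal_curvatures f z)) / 2"

definition area_measure :: "(complex \<Rightarrow> real^3) \<Rightarrow> complex measure" where
  "area_measure f = density lborel
     (\<lambda>z. ennreal (sqrt (first_ff f z 1 1 * first_ff f z \<i> \<i> - (first_ff f z 1 \<i>)\<^sup>2)))"

text \<open>The integral over the torus is the integral over one fundamental domain.\<close>

definition willmore :: "complex \<Rightarrow> (complex \<Rightarrow> real^3) \<Rightarrow> ennreal" where
  "willmore \<omega> f =
     (\<integral>\<^sup>+ z \<in> fundamental_parallelogram \<omega>. ennreal ((mean_curvature f z)\<^sup>2) \<partial>area_measure f)"

text \<open>The infimum is taken in \<open>[0, \<infinity>]\<close>. It is meant for \<open>\<omega> \<in> moduli_domain\<close>.\<close>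

definition M31 :: "complex \<Rightarrow> ennreal" where
  "M31 \<omega> = (INF f \<in> {f. conformal_immersion \<omega> f}. willmore \<omega> f)"

lemma imaginary_axis_in_moduli_domain: "Complex 0 y \<in> moduli_domain" if "y \<ge> 1"
  using that by (simp add: moduli_domain_def)

end

theory Submission
  imports Defs
begin

text \<open>
  Rotating a curve \<open>(X, Y)\<close> of the half-plane \<open>Y > 0\<close> about the axis \<open>Y = 0\<close> gives a conformal
  immersion when the curve is parametrised by hyperbolic arc length. If the curve is closed of
  length \<open>2 \<pi> y\<close>, the conformal class is \<open>\<i> y\<close>, and the Willmore energy is \<open>\<pi> / 2\<close> times the integral of
  \<open>k\<^sup>2\<close>, where \<open>k\<close> is the hyperbolic curvature. So a closed curve with energy below \<open>16\<close> is
  needed for each large length.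

  The catenary \<open>(s, cosh s)\<close> has \<open>k = 2 / cosh s\<close>, so the piece \<open>\<bar>s\<bar> \<le> S\<close> has energy \<open>8 tanh S < 8\<close>. At its
  ends it is continued along the tangent hyperbolic geodesics, which cost nothing; the two smooth
  transitions of length \<open>1 / 8\<close> cost less than the gap \<open>8 - 8 tanh S\<close>. For large \<open>S\<close> the two geodesics
  meet a common circle \<open>\<bar>z\<bar> = R\<close> orthogonally, and the inversion in this circle closes up the curve,
  with energy below \<open>16\<close>. The length depends continuously on \<open>S\<close> and is unbounded, so every large
  length occurs.
\<close>

section \<open>Smooth curves\<close>

text \<open>No continuity is demanded of the top derivative: differentiability at the next order
  supplies it, so \<open>smooth_curve\<close> is smoothness in the usual sense.\<close>

primrec Ck_curve :: "nat \<Rightarrow> (real \<Rightarrow> 'a::real_normed_vector) \<Rightarrow> bool" where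
  "Ck_curve 0 f \<longleftrightarrow> True"
| "Ck_curve (Suc k) f \<longleftrightarrow>
     (\<forall>s. f differentiable (at s)) \<and> Ck_curve k (\<lambda>s. vector_derivative f (at s))"

definition smooth_curve :: "(real \<Rightarrow> 'a::real_normed_vector) \<Rightarrow> bool" where
  "smooth_curve f \<longleftrightarrow> (\<forall>k. Ck_curve k f)"

lemma Ck_curve_SucI:
  assumes "\<And>s. (f has_vector_derivative f' s) (at s)" "Ck_curve k f'"
  shows "Ck_curve (Suc k) f"
proof -
  have "(\<lambda>s. vector_derivative f (at s)) = f'"
    using assms(1) by (auto intro: vector_derivative_at)
  then show ?thesis
    using assms by (auto intro: differentiableI_vector)
qed

lemma Ck_curve_SucD:
  assumes "Ck_curve (Suc k) f"
  obtains f' where "\<And>s. (f has_vector_derivative f' s) (at s)" "Ck_curve k f'"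
  using that[of "\<lambda>s. vector_derivative f (at s)"] assms
  by (simp add: vector_derivative_works)

lemma Ck_curve_lower: "Ck_curve (Suc k) f \<Longrightarrow> Ck_curve k f"
  by (induction k arbitrary: f) auto

lemma Ck_curve_const: "Ck_curve k (\<lambda>_. c)"
  by (induction k arbitrary: c) (auto intro!: Ck_curve_SucI derivative_eq_intros simp del: Ck_curve.simps(2))

lemma Ck_curve_id: "Ck_curve k (\<lambda>x. x)"
  by (cases k) (auto intro!: Ck_curve_SucI[where f' = "\<lambda>_. 1"] Ck_curve_const simp del: Ck_curve.simps(2))

lemma Ck_curve_add:
  "Ck_curve k f \<Longrightarrow> Ck_curve k g \<Longrightarrow> Ck_curve k (\<lambda>s. f s + g s)"
proof (induction k arbitrary: f g)
  case (Suc k)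
  from Suc.prems obtain f' g' where d: "\<And>s. (f has_vector_derivative f' s) (at s)" "Ck_curve k f'"
    "\<And>s. (g has_vector_derivative g' s) (at s)" "Ck_curve k g'"
    by (meson Ck_curve_SucD)
  show ?case
    by (rule Ck_curve_SucI[where f' = "\<lambda>s. f' s + g' s"])
       (auto intro!: d has_vector_derivative_add Suc.IH)
qed simp

lemma Ck_curve_scaleR:
  fixes f :: "real \<Rightarrow> real"
  shows "Ck_curve k f \<Longrightarrow> Ck_curve k g \<Longrightarrow> Ck_curve k (\<lambda>s. f s *\<^sub>R g s)"
proof (induction k arbitrary: f g)
  case (Suc k)
  from Suc.prems obtain f' g' where d: "\<And>s. (f has_vector_derivative f' s) (at s)" "Ck_curve k f'"
    "\<And>s. (g has_vector_derivative g' s) (at s)" "Ck_curve k g'"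
    by (meson Ck_curve_SucD)
  show ?case
    by (rule Ck_curve_SucI[where f' = "\<lambda>s. f s *\<^sub>R g' s + f' s *\<^sub>R g s"])
       (auto intro!: d has_vector_derivative_scaleR Ck_curve_add Suc.IH
          Suc.prems[THEN Ck_curve_lower] simp: has_real_derivative_iff_has_vector_derivative)
qed simp

lemma Ck_curve_compose:
  fixes g :: "real \<Rightarrow> real"
  shows "Ck_curve k f \<Longrightarrow> Ck_curve k g \<Longrightarrow> Ck_curve k (\<lambda>s. f (g s))"
proof (induction k arbitrary: f)
  case (Suc k)
  from Suc.prems obtain f' g' where d: "\<And>s. (f has_vector_derivative f' s) (at s)" "Ck_curve k f'"
    "\<And>s. (g has_vector_derivative g' s) (at s)" "Ck_curve k g'"
    by (meson Ck_curve_SucD)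
  have 1: "((\<lambda>s. f (g s)) has_vector_derivative g' s *\<^sub>R f' (g s)) (at s)" for s
    using vector_diff_chain_at[OF d(3)[of s] d(1)] by (simp add: o_def)
  show ?case
    by (rule Ck_curve_SucI[OF 1])
       (auto intro!: d Ck_curve_scaleR Suc.IH Suc.prems[THEN Ck_curve_lower])
qed simp

lemma Ck_curve_inverse:
  fixes f :: "real \<Rightarrow> real"
  shows "Ck_curve k f \<Longrightarrow> (\<And>s. f s \<noteq> 0) \<Longrightarrow> Ck_curve k (\<lambda>s. inverse (f s))"
proof (induction k)
  case (Suc k)
  from Suc.prems obtain f' where d: "\<And>s. (f has_vector_derivative f' s) (at s)" "Ck_curve k f'"
    by (meson Ck_curve_SucD)
  \<comment> \<open>The derivative is written as a product of \<open>f'\<close> and copies of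
    \<open>inverse f\<close>, so that the closure under products and the induction hypothesis
    apply.\<close>
  have 1: "((\<lambda>s. inverse (f s)) has_vector_derivative (- 1) *\<^sub>R (f' s *\<^sub>R (inverse (f s) *\<^sub>R inverse (f s)))) (at s)" for s
    using DERIV_inverse_fun[OF d(1)[of s, folded has_real_derivative_iff_has_vector_derivative] Suc.prems(2)[of s]]
    by (simp add: has_real_derivative_iff_has_vector_derivative power2_eq_square mult.assoc mult_ac)
  have 2: "Ck_curve k (\<lambda>s. inverse (f s))"
    by (rule Suc.IH) (use Suc.prems Ck_curve_lower in auto)
  show ?case
    by (rule Ck_curve_SucI[OF 1]) (intro Ck_curve_scaleR Ck_curve_const d 2)
qed simp

lemma smooth_curve_const: "smooth_curve (\<lambda>_. c)"
  and smooth_curve_id: "smooth_curve (\<lambda>x. x)"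
  by (auto simp: smooth_curve_def Ck_curve_const Ck_curve_id)

lemma smooth_curve_add: "smooth_curve f \<Longrightarrow> smooth_curve g \<Longrightarrow> smooth_curve (\<lambda>s. f s + g s)"
  and smooth_curve_scaleR:
    "smooth_curve p \<Longrightarrow> smooth_curve g \<Longrightarrow> smooth_curve (\<lambda>s. p s *\<^sub>R g s)"
  and smooth_curve_compose: "smooth_curve f \<Longrightarrow> smooth_curve p \<Longrightarrow> smooth_curve (\<lambda>s. f (p s))"
  for p :: "real \<Rightarrow> real"
  by (auto simp: smooth_curve_def intro: Ck_curve_add Ck_curve_scaleR Ck_curve_compose)

lemma smooth_curve_mult: "smooth_curve p \<Longrightarrow> smooth_curve q \<Longrightarrow> smooth_curve (\<lambda>s. p s * q s)"
  and smooth_curve_inverse: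
    "smooth_curve p \<Longrightarrow> (\<And>s. p s \<noteq> 0) \<Longrightarrow> smooth_curve (\<lambda>s. inverse (p s))"
  for p q :: "real \<Rightarrow> real"
  using smooth_curve_scaleR[of p q] by (auto simp: smooth_curve_def intro: Ck_curve_inverse)

lemma smooth_curve_minus: "smooth_curve f \<Longrightarrow> smooth_curve (\<lambda>s. - f s)"
  using smooth_curve_scaleR[OF smooth_curve_const[of "-1"]] by fastforce

lemma smooth_curve_diff: "smooth_curve f \<Longrightarrow> smooth_curve g \<Longrightarrow> smooth_curve (\<lambda>s. f s - g s)"
  using smooth_curve_add[OF _ smooth_curve_minus, of f g] by simp

lemma smooth_curve_divide:
  fixes p q :: "real \<Rightarrow> real"
  shows "smooth_curve p \<Longrightarrow> smooth_curve q \<Longrightarrow> (\<And>s. q s \<noteq> 0) \<Longrightarrow> smooth_curve (\<lambda>s. p s / q s)"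
  unfolding divide_inverse by (intro smooth_curve_mult smooth_curve_inverse)

lemmas smooth_curve_intros =
  smooth_curve_const smooth_curve_id smooth_curve_add smooth_curve_minus smooth_curve_diff
  smooth_curve_scaleR smooth_curve_mult smooth_curve_divide

lemma smooth_curve_antiderivative:
  assumes "\<And>s. (f has_vector_derivative f' s) (at s)" "smooth_curve f'"
  shows "smooth_curve f"
  unfolding smooth_curve_def
proof
  fix k
  show "Ck_curve k f"
    using assms by (cases k) (auto simp: smooth_curve_def intro!: Ck_curve_SucI simp del: Ck_curve.simps(2))
qed

lemma smooth_curve_derivative:
  assumes "smooth_curve f"
  obtains f' where "\<And>s. (f has_vector_derivative f' s) (at s)" "smooth_curve f'"
proof
  have *: "Ck_curve (Suc k) f" for k using assms by (simp add: smooth_curve_def del: Ck_curve.simps(2))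
  show "(f has_vector_derivative vector_derivative f (at s)) (at s)" for s
    using *[of 0] by (simp add: vector_derivative_works)
  show "smooth_curve (\<lambda>s. vector_derivative f (at s))"
    using * by (simp add: smooth_curve_def)
qed

lemma smooth_curve_imp_continuous: "smooth_curve f \<Longrightarrow> continuous_on A f"
  by (meson smooth_curve_derivative has_vector_derivative_continuous continuous_at_imp_continuous_on)

text \<open>The derivative inherits the local hypothesis, which allows induction on the order of
  differentiability. This handles curves glued from several pieces.\<close>

lemma smooth_curve_local:
  assumes "\<And>s. \<exists>g. smooth_curve g \<and> (\<forall>\<^sub>F t in nhds s. f t = g t)"
  shows "smooth_curve f"
proof -
  have "Ck_curve k f" if "\<And>s. \<exists>g. smooth_curve g \<and> (\<forall>\<^sub>F t in nhds s. f t = g t)" for k f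
    using that
  proof (induction k arbitrary: f)
    case (Suc k)
    define f' where "f' = (\<lambda>s. vector_derivative f (at s))"
    have *: "(f has_vector_derivative f' s) (at s) \<and> (\<exists>h. smooth_curve h \<and> (\<forall>\<^sub>F t in nhds s. f' t = h t))" for s
    proof -
      obtain g where g: "smooth_curve g" "\<forall>\<^sub>F t in nhds s. f t = g t" using Suc.prems by blast
      obtain g' where g': "\<And>s. (g has_vector_derivative g' s) (at s)" "smooth_curve g'"
        using smooth_curve_derivative[OF g(1)] by blast
      \<comment> \<open>Agreement near \<open>s\<close> is agreement near every point close to
        \<open>s\<close>; hence the derivatives agree on a neighbourhood and not just at
        \<open>s\<close>.\<close>
      have ev: "\<forall>\<^sub>F t in nhds s. \<forall>\<^sub>F u in nhds t. f u = g u"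
        using g(2) by (simp add: eventually_eventually)
      have 1: "(f has_vector_derivative g' t) (at t)" if "\<forall>\<^sub>F u in nhds t. f u = g u" for t
        using has_vector_derivative_cong_ev[where x = t and S = UNIV and f = f and g = g and f' = "g' t"]
          that eventually_nhds_x_imp_x[OF that] g'(1)[of t] by simp
      then have "\<forall>\<^sub>F t in nhds s. f' t = g' t"
        using ev by (auto elim!: eventually_mono simp: f'_def vector_derivative_at)
      moreover have "(f has_vector_derivative f' s) (at s)"
        using 1[OF g(2)] by (simp add: f'_def vector_derivative_at)
      ultimately show ?thesis using g'(2) by blast
    qed
    show ?case
      by (rule Ck_curve_SucI[where f' = f']) (use * Suc.IH in auto)
  qed simp
  from this[OF assms] show ?thesis by (simp add: smooth_curve_def)
qed

lemma smooth_curve_exp: "smooth_curve (exp :: real \<Rightarrow> real)"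
  unfolding smooth_curve_def
proof
  show "Ck_curve k (exp :: real \<Rightarrow> real)" for k
    by (induction k)
       (auto intro!: Ck_curve_SucI[where f' = exp] simp del: Ck_curve.simps(2)
         simp: DERIV_exp simp flip: has_real_derivative_iff_has_vector_derivative)
qed

lemma smooth_curve_cosh: "smooth_curve (cosh :: real \<Rightarrow> real)"
  and smooth_curve_sinh: "smooth_curve (sinh :: real \<Rightarrow> real)"
proof -
  show "smooth_curve (cosh :: real \<Rightarrow> real)" "smooth_curve (sinh :: real \<Rightarrow> real)"
    unfolding cosh_def sinh_def
    by (intro smooth_curve_intros smooth_curve_compose[OF smooth_curve_exp])+
qed

lemma smooth_curve_tanh: "smooth_curve (tanh :: real \<Rightarrow> real)"
  unfolding tanh_def by (intro smooth_curve_divide smooth_curve_cosh smooth_curve_sinh) simp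

section \<open>Primitives and a smooth step\<close>

text \<open>The auxiliary power \<open>n\<close> makes the family closed under differentiation.\<close>

definition exp_recip :: "nat \<Rightarrow> real \<Rightarrow> real" where
  "exp_recip n t = (if t \<le> 0 then 0 else inverse t ^ n * exp (- inverse t))"

lemma exp_recip_tendsto_0: "(exp_recip n \<longlongrightarrow> 0) (at 0)"
proof -
  have 1: "((\<lambda>t. inverse t ^ n / exp (inverse t)) \<longlongrightarrow> (0::real)) (at_right 0)"
    by (rule filterlim_compose[OF tendsto_power_div_exp_0 filterlim_inverse_at_top_right])
  have "(exp_recip n \<longlongrightarrow> 0) (at_right 0)"
    by (rule Lim_transform_eventually[OF 1])
       (auto simp: exp_recip_def exp_minus divide_inverse
         intro!: eventually_mono[OF eventually_at_right_less])
  moreover have "(exp_recip n \<longlongrightarrow> 0) (at_left 0)"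
    by (rule Lim_transform_eventually[OF tendsto_const])
       (simp add: exp_recip_def eventually_at_filter)
  ultimately show ?thesis by (simp add: filterlim_split_at)
qed

lemma exp_recip_has_derivative:
  "(exp_recip n has_real_derivative (exp_recip (n + 2) t - n * exp_recip (n + 1) t)) (at t)"
proof (cases t "0::real" rule: linorder_cases)
  case less
  have ev: "\<forall>\<^sub>F x in nhds t. exp_recip n x = 0"
    using eventually_nhds_in_open[of "{..<0}" t] less
    by (auto elim!: eventually_mono simp: exp_recip_def)
  show ?thesis
    using DERIV_cong_ev[OF refl ev refl, of 0] less by (simp add: exp_recip_def[of _ t])
next
  case greater
  have ev: "\<forall>\<^sub>F x in nhds t. exp_recip n x = inverse x ^ n * exp (- inverse x)"
    using eventually_nhds_in_open[of "{0<..}" t] greater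
    by (auto elim!: eventually_mono simp: exp_recip_def)
  have "((\<lambda>x. inverse x ^ n * exp (- inverse x)) has_real_derivative
      (exp_recip (n + 2) t - n * exp_recip (n + 1) t)) (at t)"
  proof (cases n)
    case (Suc m)
    then show ?thesis
      using greater
      apply (cases m)
       apply (auto intro!: derivative_eq_intros simp: exp_recip_def algebra_simps power2_eq_square)
      subgoal for k by (cases k) auto
      done
  qed (use greater in \<open>auto intro!: derivative_eq_intros simp: exp_recip_def power2_eq_square\<close>)
  then show ?thesis
    using DERIV_cong_ev[OF refl ev refl] by simp
next
  case equal
  \<comment> \<open>The difference quotient at the origin is \<open>exp_recip (Suc n)\<close>, which
    tends to zero.\<close>
  have "((\<lambda>h. (exp_recip n h - exp_recip n 0) / (h - 0)) \<longlongrightarrow> 0) (at 0)"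
    by (rule Lim_transform_eventually[OF exp_recip_tendsto_0[of "Suc n"]])
       (auto simp: exp_recip_def eventually_at divide_inverse mult_ac intro!: exI[of _ 1])
  then have "(exp_recip n has_real_derivative 0) (at 0)"
    by (simp add: has_field_derivative_iff)
  then show ?thesis using equal by (simp add: exp_recip_def)
qed

lemma smooth_curve_exp_recip: "smooth_curve (exp_recip n)"
proof -
  have "Ck_curve k (exp_recip n)" for k n
  proof (induction k arbitrary: n)
    case (Suc k)
    have "Ck_curve k (\<lambda>t. exp_recip (n + 2) t + (- real n) *\<^sub>R exp_recip (n + 1) t)"
      by (intro Ck_curve_add Ck_curve_scaleR Ck_curve_const Suc.IH)
    then show ?case
      using exp_recip_has_derivative[of n]
      by (intro Ck_curve_SucI)
         (auto simp flip: has_real_derivative_iff_has_vector_derivative)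
  qed simp
  then show ?thesis by (simp add: smooth_curve_def)
qed

text \<open>The classical quotient built from a flat function: \<open>d - t\<close> and
  \<open>t\<close> are never both non-positive, so the denominator has no zero.\<close>

lemma smooth_step_exists:
  assumes "d > (0::real)"
  obtains \<phi> :: "real \<Rightarrow> real" where "smooth_curve \<phi>" "\<And>t. 0 \<le> \<phi> t" "\<And>t. \<phi> t \<le> 1"
    "\<And>t. t \<le> 0 \<Longrightarrow> \<phi> t = 1" "\<And>t. d \<le> t \<Longrightarrow> \<phi> t = 0"
proof
  let ?h = "exp_recip 0"
  define \<phi> where "\<phi> = (\<lambda>t. ?h (d - t) / (?h (d - t) + ?h t))"
  have nn: "?h t \<ge> 0" for t by (simp add: exp_recip_def)
  have pos: "?h (d - t) + ?h t > 0" for t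
    using assms by (cases "t > 0") (auto simp: exp_recip_def add_pos_pos add_pos_nonneg)
  show "smooth_curve \<phi>"
    unfolding \<phi>_def
    by (intro smooth_curve_intros smooth_curve_compose[OF smooth_curve_exp_recip])
       (use pos in \<open>auto simp: less_le\<close>)
  show "0 \<le> \<phi> t" "\<phi> t \<le> 1" for t
    using pos[of t] nn by (auto simp: \<phi>_def divide_simps)
  show "t \<le> 0 \<Longrightarrow> \<phi> t = 1" for t using pos[of t] by (simp add: \<phi>_def exp_recip_def)
  show "d \<le> t \<Longrightarrow> \<phi> t = 0" for t by (simp add: \<phi>_def exp_recip_def)
qed

text \<open>Integrating over the fixed interval \<open>[0, 1]\<close> covers negative \<open>s\<close> as well and makes joint
  continuity in a parameter immediate.\<close>

definition primitive :: "(real \<Rightarrow> real) \<Rightarrow> real \<Rightarrow> real" where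
  "primitive g s = s * integral {0..1} (\<lambda>u. g (s * u))"

lemma primitive_0 [simp]: "primitive g 0 = 0"
  by (simp add: primitive_def)

text \<open>The substitution of \<open>t * u\<close> turns \<open>primitive g t\<close> into
  \<open>G t - G 0\<close>, where \<open>G\<close> is an indefinite integral. Its base point
  \<open>-M\<close> lies to the left of all relevant points, so both signs of \<open>t\<close> are
  treated at once.\<close>

lemma primitive_has_derivative:
  assumes "continuous_on UNIV g"
  shows "(primitive g has_real_derivative g s) (at s)"
proof -
  define M where "M = \<bar>s\<bar> + 1"
  define G where "G = (\<lambda>t. integral {-M..t} g)"
  have G: "(G has_real_derivative g t) (at t within {-M..M})" if "t \<in> {-M..M}" for t
    unfolding G_def
    by (rule integral_has_real_derivative) (use that continuous_on_subset[OF assms] in auto)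
  have eq: "primitive g t = G t - G 0" if t: "t \<in> {-M..M}" for t
  proof -
    have mem: "t * u \<in> {-M..M}" if "u \<in> {0..1}" for u
    proof -
      have "\<bar>t * u\<bar> \<le> \<bar>t\<bar> * 1" unfolding abs_mult using that by (intro mult_left_mono) auto
      then show ?thesis using t by auto
    qed
    have "((\<lambda>u. t * g (t * u)) has_integral G (t * 1) - G (t * 0)) {0..1}"
    proof (rule fundamental_theorem_of_calculus)
      fix u :: real assume u: "u \<in> {0..1}"
      have "((\<lambda>u. G (t * u)) has_real_derivative g (t * u) * t) (at u within {0..1})"
        by (rule DERIV_chain'[where f = "\<lambda>u. t * u" and g = G, THEN DERIV_subset] DERIV_image_chain[where f = G and g = "\<lambda>u. t * u", unfolded o_def])
           (auto intro!: derivative_eq_intros DERIV_subset[OF G] mem u)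
      then show "((\<lambda>u. G (t * u)) has_vector_derivative t * g (t * u)) (at u within {0..1})"
        by (simp add: has_real_derivative_iff_has_vector_derivative mult.commute)
    qed simp
    then show ?thesis
      by (simp add: primitive_def integral_unique flip: integral_mult_right)
  qed
  have s: "- M < s" "s < M" unfolding M_def by linarith+
  have "(G has_real_derivative g s) (at s)"
    using G[of s] at_within_interior[of s "{-M..M}"] s by simp
  then have "((\<lambda>t. G t - G 0) has_real_derivative g s) (at s)"
    by (auto intro!: derivative_eq_intros)
  moreover have "\<forall>\<^sub>F t in nhds s. primitive g t = G t - G 0"
  proof -
    have "\<forall>\<^sub>F t in nhds s. t \<in> {-M<..<M}"
      using s by (intro eventually_nhds_in_open) auto
    then show ?thesis by (rule eventually_mono) (auto intro: eq)
  qed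
  ultimately show ?thesis
    by (rule DERIV_cong_ev[OF refl _ refl, THEN iffD2, rotated])
qed

lemma smooth_curve_primitive:
  assumes "smooth_curve g"
  shows "smooth_curve (primitive g)"
  using primitive_has_derivative[OF smooth_curve_imp_continuous[OF assms]] assms
  unfolding has_real_derivative_iff_has_vector_derivative by (rule smooth_curve_antiderivative)

lemma continuous_on_primitive:
  fixes g :: "real \<Rightarrow> real \<Rightarrow> real"
  assumes "continuous_on UNIV (\<lambda>(S, s). g S s)"
  shows "continuous_on UNIV (\<lambda>(S, s). primitive (g S) s)"
proof -
  have "continuous_on (UNIV \<times> cbox 0 1) (\<lambda>(p, u). g (fst p) (snd p * u))"
    unfolding case_prod_beta
    by (rule continuous_on_compose2[OF assms[unfolded case_prod_beta],
          of _ "\<lambda>x. (fst (fst x), snd (fst x) * snd x)", simplified])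
       (intro continuous_intros)
  from integral_continuous_on_param[OF this] show ?thesis
    unfolding primitive_def case_prod_beta by (auto intro!: continuous_intros)
qed

lemma primitive_minus: "primitive g (- s) = - primitive (\<lambda>s. g (- s)) s"
  by (simp add: primitive_def)

lemma primitive_neg: "primitive (\<lambda>s. - g s) s = - primitive g s"
  by (simp add: primitive_def)

text \<open>The derivative of \<open>F\<close> is prescribed only between \<open>0\<close> and
  \<open>s\<close>, so a closed formula valid on one piece of the curve can be used there.\<close>

lemma primitive_eqI:
  assumes "continuous_on UNIV g" "F 0 = 0"
    and "\<And>t. t \<in> closed_segment 0 s \<Longrightarrow> (F has_real_derivative g t) (at t)"
  shows "primitive g s = F s"
proof -
  have "\<exists>c. \<forall>x\<in>closed_segment 0 s. primitive g x - F x = c"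
  proof (rule has_field_derivative_zero_constant[OF convex_closed_segment])
    fix t assume "t \<in> closed_segment 0 s"
    then show "((\<lambda>x. primitive g x - F x) has_real_derivative 0) (at t within closed_segment 0 s)"
      using DERIV_subset[OF DERIV_diff[OF primitive_has_derivative[OF assms(1), of t] assms(3)[of t]]]
      by simp
  qed
  then have "primitive g s - F s = primitive g 0 - F 0"
    by (metis ends_in_segment)
  then show ?thesis using assms(2) by simp
qed

section \<open>Profile curves in the hyperbolic half-plane\<close>

text \<open>A curve \<open>(X, Y)\<close> with hyperbolic unit tangent \<open>Y (C, N) = Y (cos \<theta>, sin \<theta>)\<close> and hyperbolic
  curvature \<open>k = \<theta>' + cos \<theta>\<close>.\<close>

definition profile_at ::
  "(real \<Rightarrow> real) \<Rightarrow> (real \<Rightarrow> real) \<Rightarrow> (real \<Rightarrow> real) \<Rightarrow> (real \<Rightarrow> real) \<Rightarrow> (real \<Rightarrow> real) \<Rightarrow> real \<Rightarrow> bool"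
where
  "profile_at X Y C N k s \<longleftrightarrow>
     0 < Y s \<and> (C s)\<^sup>2 + (N s)\<^sup>2 = 1 \<and>
     (X has_real_derivative Y s * C s) (at s) \<and>
     (Y has_real_derivative Y s * N s) (at s) \<and>
     (C has_real_derivative - N s * (k s - C s)) (at s) \<and>
     (N has_real_derivative C s * (k s - C s)) (at s)"

lemma profile_atD:
  assumes "profile_at X Y C N k s"
  shows "0 < Y s" "(C s)\<^sup>2 + (N s)\<^sup>2 = 1"
    "(X has_real_derivative Y s * C s) (at s)"
    "(Y has_real_derivative Y s * N s) (at s)"
    "(C has_real_derivative - N s * (k s - C s)) (at s)"
    "(N has_real_derivative C s * (k s - C s)) (at s)"
  using assms by (simp_all add: profile_at_def)

text \<open>Reversing the direction of travel turns the unit tangent by a half turn and changes the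
  sign of the curvature.\<close>

lemma profile_at_reflect:
  assumes "profile_at X Y C N k (p - s)"
  shows "profile_at (\<lambda>s. X (p - s)) (\<lambda>s. Y (p - s)) (\<lambda>s. - C (p - s)) (\<lambda>s. - N (p - s))
    (\<lambda>s. - k (p - s)) s"
proof -
  have *: "((\<lambda>s. f (p - s)) has_real_derivative - D) (at s)"
    if "(f has_real_derivative D) (at (p - s))" for f D
    using DERIV_chain2[OF that DERIV_diff[OF DERIV_const DERIV_ident]] by simp
  note d = profile_atD[OF assms]
  show ?thesis
    unfolding profile_at_def
    using d(1,2) *[OF d(3)] *[OF d(4)] DERIV_minus[OF *[OF d(5)]] DERIV_minus[OF *[OF d(6)]]
    by (simp add: algebra_simps)
qed

lemma profile_at_translate:
  assumes "profile_at X Y C N k (s + p)"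
  shows "profile_at (\<lambda>s. X (s + p)) (\<lambda>s. Y (s + p)) (\<lambda>s. C (s + p)) (\<lambda>s. N (s + p))
    (\<lambda>s. k (s + p)) s"
  using assms unfolding profile_at_def by (simp add: DERIV_shift)

text \<open>Inversion in the circle of radius \<open>R\<close> about the origin is an
  orientation-reversing hyperbolic isometry: unit speed is kept and the curvature changes sign. The
  new tangent is \<open>(C, N)\<close> reflected in the line orthogonal to the position vector, and
  \<open>g\<close> is the coefficient of that reflection.\<close>

lemma profile_at_invert:
  fixes X Y C N k :: "real \<Rightarrow> real"
  defines "g \<equiv> \<lambda>s. (X s * C s + Y s * N s) / ((X s)\<^sup>2 + (Y s)\<^sup>2)"
  assumes p: "profile_at X Y C N k s" and R: "R > 0"
  shows "profile_at (\<lambda>s. R\<^sup>2 * X s / ((X s)\<^sup>2 + (Y s)\<^sup>2)) (\<lambda>s. R\<^sup>2 * Y s / ((X s)\<^sup>2 + (Y s)\<^sup>2))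
    (\<lambda>s. C s - 2 * X s * g s) (\<lambda>s. N s - 2 * Y s * g s) (\<lambda>s. - k s) s"
proof -
  define r where "r = (\<lambda>s. (X s)\<^sup>2 + (Y s)\<^sup>2)"
  note Y = profile_atD(1)[OF p] and CN = profile_atD(2)[OF p] and dX = profile_atD(3)[OF p]
    and dY = profile_atD(4)[OF p] and dC = profile_atD(5)[OF p] and dN = profile_atD(6)[OF p]
  have r: "r s > 0" using Y by (simp add: r_def sum_power2_gt_zero_iff)
  then have r0: "r s \<noteq> 0" by simp
  have g: "g s * r s = X s * C s + Y s * N s" using r by (simp add: g_def r_def)
  \<comment> \<open>With the relation \<open>i * r s = 1\<close> the identities for the derivatives
    become polynomial, within reach of \<open>algebra\<close>.\<close>
  define i where "i = inverse (r s)"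
  have i: "i * r s = 1" using r by (simp add: i_def)
  have dr: "(r has_real_derivative 2 * Y s * g s * r s) (at s)"
    unfolding r_def
    by (rule derivative_eq_intros dX dY refl)+ (use g[unfolded r_def] in \<open>simp add: r_def, algebra\<close>)
  have quot: "((\<lambda>s. f s / r s) has_real_derivative (D - f s * (2 * Y s * g s)) * i) (at s)"
    if "(f has_real_derivative D) (at s)" for f D
    by (rule DERIV_cong[OF DERIV_divide[OF that dr r0]])
       (use r in \<open>simp add: i_def field_simps\<close>)
  have "((\<lambda>s. X s * C s + Y s * N s) has_real_derivative
      Y s + (k s - C s) * (Y s * C s - X s * N s)) (at s)"
    by (rule derivative_eq_intros dX dY dC dN refl)+ (use CN in algebra)
  from quot[OF this] have dg: "(g has_real_derivative ((Y s + (k s - C s) * (Y s * C s - X s * N s))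
      - (X s * C s + Y s * N s) * (2 * Y s * g s)) * i) (at s)"
    by (simp add: g_def r_def)
  have gi: "g s = (X s * C s + Y s * N s) * i" by (simp add: g_def r_def i_def divide_inverse)
  have rs: "r s = (X s)\<^sup>2 + (Y s)\<^sup>2" by (simp add: r_def)
  have 1: "((\<lambda>s. R\<^sup>2 * X s / r s) has_real_derivative
      (R\<^sup>2 * Y s / r s) * (C s - 2 * X s * g s)) (at s)"
    by (rule DERIV_cong[OF quot[OF DERIV_cmult[OF dX]]])
       (simp add: i_def divide_inverse algebra_simps)
  have 2: "((\<lambda>s. R\<^sup>2 * Y s / r s) has_real_derivative
      (R\<^sup>2 * Y s / r s) * (N s - 2 * Y s * g s)) (at s)"
    by (rule DERIV_cong[OF quot[OF DERIV_cmult[OF dY]]])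
       (simp add: i_def divide_inverse algebra_simps)
  have 3: "((\<lambda>s. C s - 2 * X s * g s) has_real_derivative
      - (N s - 2 * Y s * g s) * (- k s - (C s - 2 * X s * g s))) (at s)"
    by (rule DERIV_cong[OF DERIV_diff[OF dC DERIV_mult[OF DERIV_cmult[OF dX] dg]]])
       (use CN i gi rs in algebra)
  have 4: "((\<lambda>s. N s - 2 * Y s * g s) has_real_derivative
      (C s - 2 * X s * g s) * (- k s - (C s - 2 * X s * g s))) (at s)"
    by (rule DERIV_cong[OF DERIV_diff[OF dN DERIV_mult[OF DERIV_cmult[OF dY] dg]]])
       (use CN i gi rs in algebra)
  have 5: "(C s - 2 * X s * g s)\<^sup>2 + (N s - 2 * Y s * g s)\<^sup>2 = 1"
    using CN i gi rs by algebra
  show ?thesis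
    unfolding profile_at_def using 1 2 3 4 5 Y R r by (simp add: r_def)
qed

text \<open>Position determines the tangent by one differentiation and the curvature by a second
  one. Thus only positions need to be matched when curves are glued.\<close>

lemma profile_at_unique:
  assumes p: "\<And>s. profile_at X Y C N k s" and q: "\<And>s. profile_at X' Y' C' N' k' s"
    and ev: "\<forall>\<^sub>F s in nhds t. X s = X' s \<and> Y s = Y' s"
  shows "C t = C' t \<and> N t = N' t \<and> k t = k' t"
proof -
  have same_derivative: "D = D'"
    if "\<forall>\<^sub>F s in nhds u. f s = g s" "(f has_real_derivative D) (at u)" "(g has_real_derivative D') (at u)"
    for f g :: "real \<Rightarrow> real" and D D' u
    using DERIV_unique[OF that(2)] DERIV_cong_ev[OF refl that(1) refl, of D'] that(3) by simp
  have CN: "C u = C' u \<and> N u = N' u" if ev: "\<forall>\<^sub>F s in nhds u. X s = X' s \<and> Y s = Y' s" for u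
  proof -
    have eX: "\<forall>\<^sub>F s in nhds u. X s = X' s" and eY: "\<forall>\<^sub>F s in nhds u. Y s = Y' s"
      using ev by (auto elim: eventually_mono)
    have "Y u = Y' u" "Y u > 0"
      using eventually_nhds_x_imp_x[OF ev] p[of u] by (auto simp: profile_at_def)
    moreover have "Y u * C u = Y' u * C' u"
      by (rule same_derivative[OF eX profile_atD(3)[OF p] profile_atD(3)[OF q]])
    moreover have "Y u * N u = Y' u * N' u"
      by (rule same_derivative[OF eY profile_atD(4)[OF p] profile_atD(4)[OF q]])
    ultimately show ?thesis by simp
  qed
  have ev2: "\<forall>\<^sub>F u in nhds t. C u = C' u \<and> N u = N' u"
  proof -
    have "\<forall>\<^sub>F u in nhds t. \<forall>\<^sub>F s in nhds u. X s = X' s \<and> Y s = Y' s"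
      using ev by (simp add: eventually_eventually)
    then show ?thesis by (rule eventually_mono) (rule CN)
  qed
  have eC: "\<forall>\<^sub>F s in nhds t. C s = C' s" and eN: "\<forall>\<^sub>F s in nhds t. N s = N' s"
    using ev2 by (auto elim: eventually_mono)
  have eq: "C t = C' t" "N t = N' t" using CN[OF ev] by auto
  have "N t * (k t - C t) = N' t * (k' t - C' t)"
    using same_derivative[OF eC profile_atD(5)[OF p] profile_atD(5)[OF q]] by linarith
  moreover have "C t * (k t - C t) = C' t * (k' t - C' t)"
    by (rule same_derivative[OF eN profile_atD(6)[OF p] profile_atD(6)[OF q]])
  moreover have "(C t)\<^sup>2 + (N t)\<^sup>2 = 1" using p[of t] by (simp add: profile_at_def)
  \<comment> \<open>The two equations are multiplied by \<open>N t\<close> and \<open>C t\<close>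
    and added.\<close>
  ultimately have "k t = k' t"
    unfolding eq[symmetric] by algebra
  then show ?thesis using eq by simp
qed

lemma profile_at_cong:
  assumes "profile_at X Y C N k s"
    and "\<forall>\<^sub>F t in nhds s. X' t = X t \<and> Y' t = Y t \<and> C' t = C t \<and> N' t = N t \<and> k' t = k t"
  shows "profile_at X' Y' C' N' k' s"
proof -
  have "\<forall>\<^sub>F t in nhds s. X' t = X t" "\<forall>\<^sub>F t in nhds s. Y' t = Y t" "\<forall>\<^sub>F t in nhds s. C' t = C t"
    "\<forall>\<^sub>F t in nhds s. N' t = N t"
    using assms(2) by (auto elim: eventually_mono)
  note * = this[THEN DERIV_cong_ev[OF refl _ refl]]
  show ?thesis
    using assms(1) eventually_nhds_x_imp_x[OF assms(2)] unfolding profile_at_def * by simp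
qed

lemma sech_sq_plus_tanh_sq: "(1 / cosh x)\<^sup>2 + (tanh x)\<^sup>2 = 1" for x :: real
proof -
  have "(1 / cosh x)\<^sup>2 + (tanh x)\<^sup>2 = ((sinh x)\<^sup>2 + 1) / (cosh x)\<^sup>2"
    by (simp add: tanh_def power_divide add_divide_distrib)
  then show ?thesis unfolding cosh_square_eq[symmetric] by simp
qed

text \<open>Here the tangent angle is the Gudermannian of \<open>v\<close>, with derivative
  \<open>v' / cosh v\<close>; adding the cosine \<open>1 / cosh v\<close> gives the curvature. The
  trajectory always moves in the direction of increasing \<open>X\<close>.\<close>

lemma profile_at_tanh:
  assumes v: "(v has_real_derivative v' s) (at s)"
    and X: "(X has_real_derivative Y s / cosh (v s)) (at s)"
    and Y: "(Y has_real_derivative Y s * tanh (v s)) (at s)" "Y s > 0"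
  shows "profile_at X Y (\<lambda>s. 1 / cosh (v s)) (\<lambda>s. tanh (v s)) (\<lambda>s. (1 + v' s) / cosh (v s)) s"
proof -
  have c: "cosh (v s) \<noteq> 0" by simp
  note pyth = sech_sq_plus_tanh_sq[of "v s"]
  have 1: "((\<lambda>s. 1 / cosh (v s)) has_real_derivative - tanh (v s) * ((1 + v' s) / cosh (v s) - 1 / cosh (v s))) (at s)"
    by (rule DERIV_cong[OF DERIV_divide[OF DERIV_const DERIV_chain2[OF has_field_derivative_cosh[OF DERIV_ident] v] c]])
       (simp add: tanh_def divide_simps)
  have 2: "((\<lambda>s. tanh (v s)) has_real_derivative (1 - (tanh (v s))\<^sup>2) * v' s) (at s)"
    by (rule derivative_eq_intros v refl c)+
  have 3: "(1 - (tanh (v s))\<^sup>2) * v' s = 1 / cosh (v s) * ((1 + v' s) / cosh (v s) - 1 / cosh (v s))"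
  proof -
    have "1 - (tanh (v s))\<^sup>2 = (1 / cosh (v s))\<^sup>2" using pyth by linarith
    then show ?thesis by (simp add: power2_eq_square divide_simps)
  qed
  show ?thesis
    using X Y pyth 1 2[unfolded 3] unfolding profile_at_def by simp
qed

section \<open>A catenoid blended into a geodesic\<close>

text \<open>If a geodesic passes through a point with \<open>X / Y = q\<close> at distance \<open>w\<close> before its top,
  then the circle about the origin that it meets orthogonally is at distance \<open>mirror_shift q w\<close>
  before the top.\<close>

definition mirror_shift :: "real \<Rightarrow> real \<Rightarrow> real" where
  "mirror_shift q w = ln ((q + exp w) / (q - exp (- w))) / 2"

text \<open>The last equation, with \<open>b\<close> for the shift, is linear in
  \<open>exp b\<close> and \<open>exp (- b)\<close>: it reads
  \<open>exp (2 * b) * (q - exp (- w)) = q + exp w\<close>, whence the logarithm. The hypothesis on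
  \<open>q * sinh w\<close> is what yields \<open>b < w\<close>, so that the circle is met only
  after the given point has been passed.\<close>

lemma mirror_shift:
  assumes w: "w > 0" and q: "q * sinh w > 1"
  shows "q > exp (- w)" "0 < mirror_shift q w" "mirror_shift q w < w"
    "q * sinh (mirror_shift q w) = cosh (mirror_shift q w - w)"
proof -
  have sw: "sinh w > 0" using w by simp
  have "sinh w * exp (- w) < 1"
    using w by (simp add: sinh_def algebra_simps flip: exp_add)
      (smt (verit) exp_gt_zero)
  then have "sinh w * exp (- w) < sinh w * q" using q by (simp add: mult.commute)
  then show qw: "q > exp (- w)" using sw by simp
  define r where "r = (q + exp w) / (q - exp (- w))"
  have r1: "r > 1" using qw w by (simp add: r_def) (smt (verit) exp_gt_zero)
  show "0 < mirror_shift q w" using r1 by (simp add: mirror_shift_def r_def[symmetric])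
  have "q * exp w - q * exp (- w) > 2"
    using q by (simp add: sinh_def algebra_simps)
  then have "exp w * (q * exp w - q * exp (- w)) > exp w * 2"
    by (intro mult_strict_left_mono) auto
  then have "q + exp w < exp (2 * w) * (q - exp (- w))"
    by (simp add: algebra_simps flip: exp_add)
  then have "r < exp (2 * w)" using qw by (simp add: r_def divide_simps)
  then have "ln r < 2 * w" using r1 by (metis exp_gt_zero ln_exp ln_less_cancel_iff less_trans zero_less_one)
  then show "mirror_shift q w < w" by (simp add: mirror_shift_def r_def[symmetric])
  define b where "b = mirror_shift q w"
  have "exp (2 * b) = r" using r1 by (simp add: b_def mirror_shift_def r_def[symmetric])
  then have "exp (2 * b) * (q - exp (- w)) = q + exp w" using qw by (simp add: r_def)
  then have "exp (- b) * (exp (2 * b) * (q - exp (- w))) = exp (- b) * (q + exp w)" by simp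
  then have "exp b * (q - exp (- w)) = exp (- b) * (q + exp w)"
    by (simp add: mult.assoc[symmetric] flip: exp_add)
  then show "q * sinh (mirror_shift q w) = cosh (mirror_shift q w - w)"
    unfolding b_def[symmetric]
    by (simp add: sinh_def cosh_def algebra_simps flip: exp_add)
qed

text \<open>Evaluates the squared distance from the origin of a point on the geodesic tail.\<close>

lemma cosh_sq_plus_sinh_sq:
  "(cosh x)\<^sup>2 + (sinh y)\<^sup>2 = cosh (x + y) * cosh (x - y)" for x y :: real
proof -
  have "cosh (x + y) * cosh (x - y) = (cosh x)\<^sup>2 * (cosh y)\<^sup>2 - (sinh x)\<^sup>2 * (sinh y)\<^sup>2"
    by (simp add: cosh_add cosh_diff algebra_simps power2_eq_square)
  then show ?thesis by (simp add: cosh_square_eq algebra_simps)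
qed

text \<open>The exponent is twice the transition length \<open>1 / 8\<close>; the factor
  \<open>exp (1 / 4)\<close> is what the transition costs in the exponential estimates.\<close>

lemma exp_quarter_less_2: "exp (1 / 4 :: real) < 2"
proof (rule power_less_imp_less_base[of _ 4])
  have "exp (1 / 4 :: real) ^ 4 = exp 1" by (simp flip: exp_of_nat_mult)
  then show "exp (1 / 4 :: real) ^ 4 < 2 ^ 4" using exp_le by simp
qed simp

text \<open>With \<open>C = 1 / cosh v\<close> and \<open>N = tanh v\<close> the curvature is \<open>(1 + v') / cosh v\<close>: slope \<open>1\<close> of \<open>v\<close>
  gives the catenary and slope \<open>-1\<close> a geodesic.\<close>

locale blend =
  fixes \<phi> :: "real \<Rightarrow> real"
  assumes smooth_phi: "smooth_curve \<phi>"
    and phi_nonneg: "0 \<le> \<phi> t" and phi_le_1: "\<phi> t \<le> 1"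
    and phi_left: "t \<le> 0 \<Longrightarrow> \<phi> t = 1" and phi_right: "1 / 8 \<le> t \<Longrightarrow> \<phi> t = 0"
begin

definition "Phi = primitive \<phi>"

text \<open>For \<open>S \<ge> 0\<close> the slope is \<open>2 + 2 - 3 = 1\<close> on the core
  between \<open>-S\<close> and \<open>S\<close>, and \<open>0 + 2 - 3 = -1\<close> beyond distance
  \<open>S + 1 / 8\<close> from the origin. The two terms in \<open>Phi\<close> are arranged to make
  \<open>v S\<close> odd.\<close>

definition "v S s = 2 * Phi (s - S) - 2 * Phi (- s - S) - 3 * s"

definition "v' S s = 2 * \<phi> (s - S) + 2 * \<phi> (- s - S) - 3"

definition "Y S s = exp (primitive (\<lambda>s. tanh (v S s)) s)"

definition "X S = primitive (\<lambda>s. Y S s / cosh (v S s))"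

definition "k S s = (1 + v' S s) / cosh (v S s)"

definition "J S = primitive (\<lambda>s. (k S s)\<^sup>2)"

text \<open>On the tail \<open>v\<close> falls with slope \<open>-1\<close> and vanishes at the top
  of the geodesic, so \<open>w S\<close> is the distance from the end of the transition to the top.
  Accordingly \<open>\<beta> S\<close> is the distance from the mirror circle to the top,
  \<open>len S\<close> the arc length at which the curve meets that circle, and \<open>R S\<close>
  the radius of the circle.\<close>

definition "w S = v S (S + 1 / 8)"

definition "q S = X S (S + 1 / 8) / Y S (S + 1 / 8)"

definition "\<beta> S = mirror_shift (q S) (w S)"

definition "len S = S + 1 / 8 + w S - \<beta> S"

definition "R S = Y S (S + 1 / 8) * cosh (w S) / sinh (\<beta> S)"

section \<open>The function \<open>v\<close> on the core and on the tail\<close>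

lemma Phi_has_derivative: "(Phi has_real_derivative \<phi> t) (at t)"
  unfolding Phi_def by (intro primitive_has_derivative smooth_curve_imp_continuous smooth_phi)

lemma smooth_Phi: "smooth_curve Phi"
  unfolding Phi_def by (intro smooth_curve_primitive smooth_phi)

lemma Phi_left: "Phi t = t" if "t \<le> 0"
  unfolding Phi_def
proof (rule primitive_eqI[OF smooth_curve_imp_continuous[OF smooth_phi]])
  fix u assume "u \<in> closed_segment 0 t"
  then have "\<phi> u = 1" using that by (intro phi_left) (auto simp: closed_segment_eq_real_ivl split: if_splits)
  then show "((\<lambda>t. t) has_real_derivative \<phi> u) (at u)" by simp
qed simp

lemma Phi_right: "Phi t = Phi (1 / 8)" if "1 / 8 \<le> t"
proof -
  have "\<exists>c. \<forall>x\<in>{1 / 8..}. Phi x = c"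
    by (rule has_field_derivative_zero_constant)
       (auto intro!: DERIV_subset[OF Phi_has_derivative, THEN DERIV_cong] phi_right)
  then show ?thesis using that by (metis atLeast_iff order_refl)
qed

lemma Phi_nonneg: "0 \<le> Phi t" if "0 \<le> t"
  unfolding Phi_def primitive_def using that
  by (intro mult_nonneg_nonneg integral_nonneg integrable_continuous_real
        smooth_curve_imp_continuous smooth_curve_compose[OF smooth_phi] smooth_curve_intros phi_nonneg) auto

lemma smooth_v: "smooth_curve (v S)"
  unfolding v_def by (intro smooth_curve_intros smooth_curve_compose[OF smooth_Phi])

lemma v_has_derivative: "(v S has_real_derivative v' S s) (at s)"
proof -
  have "((\<lambda>s. 2 * Phi (s - S) - 2 * Phi (- s - S) - 3 * s) has_real_derivative
      2 * (\<phi> (s - S) * (1 - 0)) - 2 * (\<phi> (- s - S) * (- 1 - 0)) - 3 * 1) (at s)"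
    by (intro DERIV_diff DERIV_cmult DERIV_chain2[OF Phi_has_derivative] DERIV_ident DERIV_const DERIV_minus)
  then show ?thesis unfolding v_def[abs_def] v'_def by (simp add: algebra_simps)
qed

lemma v_odd: "v S (- s) = - v S s" and v'_even: "v' S (- s) = v' S s"
  by (simp_all add: v_def v'_def)

text \<open>On the right half only the transition at \<open>S\<close> is felt, since
  \<open>Phi\<close> is still the identity in the other term.\<close>

lemma v_nonneg_arg: "v S s = 2 * Phi (s - S) + 2 * S - s" if "0 \<le> s" "0 \<le> S"
  using that Phi_left[of "- s - S"] by (simp add: v_def)

lemma v_core: "v S s = s" if "0 \<le> s" "s \<le> S"
  using that Phi_left[of "s - S"] by (simp add: v_nonneg_arg)

lemma v_tail: "v S s = w S + S + 1 / 8 - s" if "S + 1 / 8 \<le> s" "0 \<le> S"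
  using that Phi_right[of "s - S"] by (simp add: w_def v_nonneg_arg)

lemma w_ge: "S - 1 / 8 \<le> w S" if "0 \<le> S"
  using that Phi_nonneg[of "1 / 8"] by (simp add: w_def v_nonneg_arg)

section \<open>The profile curve generated by \<open>v\<close> and its symmetries\<close>

lemma smooth_Y: "smooth_curve (Y S)"
  unfolding Y_def
  by (intro smooth_curve_compose[OF smooth_curve_exp] smooth_curve_primitive
        smooth_curve_compose[OF smooth_curve_tanh] smooth_v)

lemma smooth_cosh_v: "smooth_curve (\<lambda>s. cosh (v S s))"
  by (intro smooth_curve_compose[OF smooth_curve_cosh] smooth_v)

lemma smooth_X': "smooth_curve (\<lambda>s. Y S s / cosh (v S s))"
  by (intro smooth_curve_divide smooth_Y smooth_cosh_v) auto

lemma smooth_X: "smooth_curve (X S)"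
  unfolding X_def by (intro smooth_curve_primitive smooth_X')

lemma smooth_k: "smooth_curve (k S)"
  unfolding k_def v'_def
  by (intro smooth_curve_intros smooth_cosh_v smooth_curve_compose[OF smooth_phi]) auto

lemma Y_pos: "Y S s > 0"
  by (simp add: Y_def)

lemma X_has_derivative: "(X S has_real_derivative Y S s / cosh (v S s)) (at s)"
  unfolding X_def by (rule primitive_has_derivative[OF smooth_curve_imp_continuous[OF smooth_X']])

lemma Y_has_derivative: "(Y S has_real_derivative Y S s * tanh (v S s)) (at s)"
  unfolding Y_def
  by (intro DERIV_chain2[OF DERIV_exp] primitive_has_derivative smooth_curve_imp_continuous
        smooth_curve_compose[OF smooth_curve_tanh] smooth_v)

lemma profile: "profile_at (X S) (Y S) (\<lambda>s. 1 / cosh (v S s)) (\<lambda>s. tanh (v S s)) (k S) s"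
  unfolding k_def by (intro profile_at_tanh v_has_derivative X_has_derivative Y_has_derivative Y_pos)

lemma Y_even: "Y S (- s) = Y S s"
  by (simp add: Y_def primitive_minus v_odd primitive_neg)

lemma X_odd: "X S (- s) = - X S s"
  by (simp add: X_def primitive_minus Y_even v_odd)

lemma k_even: "k S (- s) = k S s"
  by (simp add: k_def v'_even v_odd)

lemma J_odd: "J S (- s) = - J S s"
  by (simp add: J_def primitive_minus k_even)

lemma J_has_derivative: "(J S has_real_derivative (k S s)\<^sup>2) (at s)"
  unfolding J_def power2_eq_square
  by (intro primitive_has_derivative smooth_curve_imp_continuous smooth_curve_mult smooth_k)

section \<open>The catenary core and energy estimates\<close>

lemma Y_core: "Y S s = cosh s" if "0 \<le> s" "s \<le> S"
proof -
  have "primitive (\<lambda>s. tanh (v S s)) s = ln (cosh s)"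
  proof (rule primitive_eqI)
    fix t assume "t \<in> closed_segment 0 s"
    then have t: "v S t = t" using that by (intro v_core) (auto simp: closed_segment_eq_real_ivl)
    show "((\<lambda>t. ln (cosh t)) has_real_derivative tanh (v S t)) (at t)"
      unfolding t by (auto intro!: derivative_eq_intros simp: tanh_def)
  qed (auto intro: smooth_curve_imp_continuous smooth_curve_compose[OF smooth_curve_tanh] smooth_v)
  then show ?thesis by (simp add: Y_def)
qed

lemma X_core: "X S s = s" if "0 \<le> s" "s \<le> S"
  unfolding X_def
proof (rule primitive_eqI[OF smooth_curve_imp_continuous[OF smooth_X']])
  fix t assume "t \<in> closed_segment 0 s"
  then have t: "0 \<le> t" "t \<le> S" using that by (auto simp: closed_segment_eq_real_ivl)
  show "((\<lambda>t. t) has_real_derivative Y S t / cosh (v S t)) (at t)"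
    using t by (simp add: Y_core v_core)
qed simp

lemma J_core: "J S S = 4 * tanh S" if "0 \<le> S"
  unfolding J_def power2_eq_square
proof (rule primitive_eqI)
  fix t assume "t \<in> closed_segment 0 S"
  then have t: "0 \<le> t" "t \<le> S" using that by (auto simp: closed_segment_eq_real_ivl)
  have "(1 - (tanh t)\<^sup>2) = 1 / (cosh t)\<^sup>2"
    using sech_sq_plus_tanh_sq[of t] by (simp add: power_divide)
  moreover have "((\<lambda>t. 4 * tanh t) has_real_derivative 4 * ((1 - (tanh t)\<^sup>2) * 1)) (at t)"
    by (intro DERIV_cmult) (auto intro!: derivative_eq_intros)
  moreover have "k S t = 2 / cosh t"
    using t by (simp add: k_def v'_def v_core phi_left)
  ultimately show "((\<lambda>t. 4 * tanh t) has_real_derivative k S t * k S t) (at t)"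
    by (simp add: power2_eq_square)
qed (auto intro!: smooth_curve_imp_continuous smooth_curve_mult smooth_k)

text \<open>On the transition the slope of \<open>v\<close> lies between \<open>-1\<close> and
  \<open>1\<close>, so \<open>0 \<le> k \<le> 2 / cosh v\<close>, and
  \<open>v \<ge> S - 1 / 8\<close>. Thus \<open>k\<^sup>2\<close> is at most \<open>M\<close>, over
  a length of \<open>1 / 8\<close>.\<close>

lemma J_blend: "J S (S + 1 / 8) \<le> J S S + 1 / (2 * (cosh (S - 1 / 8))\<^sup>2)" if "1 \<le> S"
proof -
  define M where "M = 4 / (cosh (S - 1 / 8))\<^sup>2"
  have "J S (S + 1 / 8) - M * (S + 1 / 8) \<le> J S S - M * S"
  proof (rule DERIV_nonpos_imp_nonincreasing[where f = "\<lambda>s. J S s - M * s"])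
    fix s assume s: "S \<le> s" "s \<le> S + 1 / 8"
    have d: "((\<lambda>s. J S s - M * s) has_real_derivative (k S s)\<^sup>2 - M * 1) (at s)"
      by (intro DERIV_diff J_has_derivative DERIV_cmult DERIV_ident)
    have "S - 1 / 8 \<le> v S s"
      using s that Phi_nonneg[of "s - S"] by (simp add: v_nonneg_arg)
    then have c: "cosh (S - 1 / 8) \<le> cosh (v S s)"
      using that by (simp add: cosh_real_nonneg_le_iff)
    have "0 \<le> 1 + v' S s" "1 + v' S s \<le> 2"
      using s that phi_left[of "- s - S"] phi_nonneg[of "s - S"] phi_le_1[of "s - S"] by (auto simp: v'_def)
    then have "0 \<le> k S s" "k S s \<le> 2 / cosh (S - 1 / 8)"
      unfolding k_def using c by (auto intro!: frac_le)
    then have "(k S s)\<^sup>2 \<le> (2 / cosh (S - 1 / 8))\<^sup>2" by (intro power_mono)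
    also have "\<dots> = M" by (simp add: M_def power_divide)
    finally show "\<exists>y. ((\<lambda>s. J S s - M * s) has_real_derivative y) (at s) \<and> y \<le> 0"
      using d by auto
  qed simp
  then have "J S (S + 1 / 8) \<le> J S S + M / 8" by (simp add: distrib_left)
  then show ?thesis by (simp add: M_def)
qed

lemma J_tail: "J S s = J S (S + 1 / 8)" if "S + 1 / 8 \<le> s" "0 \<le> S"
proof -
  have "\<exists>c. \<forall>x\<in>{S + 1 / 8..}. J S x = c"
  proof (rule has_field_derivative_zero_constant)
    fix x assume x: "x \<in> {S + 1 / 8..}"
    have "k S x = 0"
      using x that phi_left[of "- x - S"] phi_right[of "x - S"] by (simp add: k_def v'_def)
    then show "(J S has_real_derivative 0) (at x within {S + 1 / 8..})"
      using DERIV_subset[OF J_has_derivative[of S x]] by simp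
  qed simp
  then show ?thesis using that by (metis atLeast_iff order_refl)
qed

text \<open>The gap \<open>4 - 4 * tanh S = 8 / (exp (2 * S) + 1)\<close> is at least
  \<open>4 / exp (2 * S)\<close>, whereas the transition costs at most
  \<open>2 * exp (1 / 4) / exp (2 * S)\<close>, which is smaller because
  \<open>exp (1 / 4) < 2\<close>.\<close>

lemma J_less_4: "J S s < 4" if "S + 1 / 8 \<le> s" "1 \<le> S"
proof -
  note e = exp_quarter_less_2
  have "exp (S - 1 / 8) / 2 \<le> cosh (S - 1 / 8)" by (simp add: cosh_def)
  then have "(exp (S - 1 / 8) / 2)\<^sup>2 \<le> (cosh (S - 1 / 8))\<^sup>2" by (intro power_mono) auto
  moreover have "(exp (S - 1 / 8) / 2)\<^sup>2 * exp (1 / 4) = exp (2 * S) / 4"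
    by (simp add: power2_eq_square flip: exp_add)
  ultimately have 1: "exp (2 * S) / 4 \<le> (cosh (S - 1 / 8))\<^sup>2 * exp (1 / 4)"
    by (metis exp_ge_zero mult_right_mono)
  also have "\<dots> < (cosh (S - 1 / 8))\<^sup>2 * 2" using e by (intro mult_strict_left_mono) auto
  finally have 2: "1 / (2 * (cosh (S - 1 / 8))\<^sup>2) < 4 / exp (2 * S)"
    by (simp add: divide_simps mult.commute)
  have "4 * (1 - tanh S) = 8 / (exp (2 * S) + 1)"
  proof -
    define E where "E = exp (2 * S)"
    have E: "E > 0" by (simp add: E_def)
    have "exp (- 2 * S) = 1 / E" by (simp add: E_def exp_minus divide_inverse)
    then have "tanh S = (1 - 1 / E) / (1 + 1 / E)" by (simp add: tanh_real_altdef)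
    also have "\<dots> = (E - 1) / (E + 1)" using E by (simp add: divide_simps)
    finally show ?thesis using E unfolding E_def[symmetric] by (simp add: field_simps)
  qed
  moreover have "4 / exp (2 * S) \<le> 8 / (exp (2 * S) + 1)"
    using that add_pos_pos[OF exp_gt_zero[of "2 * S"] zero_less_one] by (simp add: divide_simps)
  moreover have "0 \<le> S" using that by simp
  ultimately show ?thesis
    using J_tail[OF that(1)] J_blend[OF that(2)] J_core 2 by fastforce
qed

text \<open>At the end of the transition \<open>Y\<close> is at most \<open>exp (S + 1 / 8)\<close>,
  while \<open>X \<ge> S\<close> and \<open>sinh (w S) \<ge> exp (S - 1 / 8) / 4\<close>. The linear
  growth of \<open>X\<close> decides: for \<open>S \<ge> 10\<close> one has
  \<open>S / 4 \<ge> 2 > exp (1 / 4)\<close>.\<close>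

lemma closing_condition: "1 < q S * sinh (w S)" if "10 \<le> S"
proof -
  \<comment> \<open>The logarithmic derivative \<open>tanh v\<close> of \<open>Y\<close> is below
    one, so \<open>Y\<close> grows more slowly than the exponential.\<close>
  have "Y S (S + 1 / 8) * exp (- (S + 1 / 8)) \<le> Y S S * exp (- S)"
  proof (rule DERIV_nonpos_imp_nonincreasing[where f = "\<lambda>s. Y S s * exp (- s)"])
    fix s
    have "((\<lambda>s. Y S s * exp (- s)) has_real_derivative
        Y S s * exp (- s) * (tanh (v S s) - 1)) (at s)"
      by (auto intro!: derivative_eq_intros Y_has_derivative simp: algebra_simps)
    moreover have "Y S s * exp (- s) * (tanh (v S s) - 1) \<le> 0"
      using Y_pos[of S s] tanh_real_lt_1[of "v S s"] by (intro mult_nonneg_nonpos) auto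
    ultimately show "\<exists>y. ((\<lambda>s. Y S s * exp (- s)) has_real_derivative y) (at s) \<and> y \<le> 0"
      by blast
  qed simp
  moreover have "Y S S * exp (- S) \<le> 1"
  proof -
    have "1 \<le> exp S * exp S" using that by (simp flip: exp_add)
    then show ?thesis using that by (simp add: Y_core cosh_def exp_minus field_simps)
  qed
  ultimately have "Y S (S + 1 / 8) * exp (- (S + 1 / 8)) \<le> 1" by linarith
  then have Yb: "Y S (S + 1 / 8) \<le> exp (S + 1 / 8)" by (simp add: exp_minus field_simps)
  have "X S S \<le> X S (S + 1 / 8)"
  proof (rule DERIV_nonneg_imp_nondecreasing[where f = "X S"])
    fix s show "\<exists>y. (X S has_real_derivative y) (at s) \<and> 0 \<le> y"
      using X_has_derivative[of S s] Y_pos[of S s] by (auto intro!: exI[of _ "Y S s / cosh (v S s)"])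
  qed simp
  then have Xb: "S \<le> X S (S + 1 / 8)" using that by (simp add: X_core)
  have "exp (- (S - 1 / 8)) \<le> exp (S - 1 / 8) / 2"
  proof -
    have "2 \<le> exp (2 * (S - 1 / 8))" using that by (intro order_trans[OF _ exp_ge_add_one_self]) simp
    also have "\<dots> = exp (S - 1 / 8) / exp (- (S - 1 / 8))" by (simp flip: exp_diff)
    finally show ?thesis by (simp add: field_simps)
  qed
  then have sb: "exp (S - 1 / 8) / 4 \<le> sinh (S - 1 / 8)"
    by (simp add: sinh_def)
  also have "\<dots> \<le> sinh (w S)" using w_ge[of S] that by simp
  finally have sw: "exp (S - 1 / 8) / 4 \<le> sinh (w S)" .
  note e = exp_quarter_less_2
  have "exp (S + 1 / 8) = exp (S - 1 / 8) * exp (1 / 4)" by (simp flip: exp_add)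
  also have "\<dots> < exp (S - 1 / 8) * 2" using e by (intro mult_strict_left_mono) auto
  also have "\<dots> \<le> S * (exp (S - 1 / 8) / 4)" using that by simp
  also have "\<dots> \<le> X S (S + 1 / 8) * sinh (w S)" using Xb sw that by (intro mult_mono) auto
  finally have "Y S (S + 1 / 8) < X S (S + 1 / 8) * sinh (w S)" using Yb by linarith
  then show ?thesis using Y_pos[of S "S + 1 / 8"] by (simp add: q_def divide_simps)
qed

section \<open>The geodesic tail and its mirror circle\<close>

lemma mirror:
  assumes "10 \<le> S"
  shows "q S > exp (- w S)" "0 < \<beta> S" "\<beta> S < w S" "q S * sinh (\<beta> S) = cosh (\<beta> S - w S)"
proof -
  have "w S > 0" using w_ge[of S] assms by simp
  from mirror_shift[OF this closing_condition[OF assms]]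
  show "q S > exp (- w S)" "0 < \<beta> S" "\<beta> S < w S" "q S * sinh (\<beta> S) = cosh (\<beta> S - w S)"
    by (simp_all add: \<beta>_def)
qed

lemma less_len: "S + 1 / 8 < len S" if "10 \<le> S"
  using mirror(3)[OF that] by (simp add: len_def)

lemma R_pos: "R S > 0" if "10 \<le> S"
  using mirror(2)[OF that] Y_pos by (simp add: R_def)

text \<open>The tail is a hyperbolic geodesic, written with arc length counted from
  \<open>len S\<close>. At \<open>s = len S\<close> the formulas give a point at distance
  \<open>R S\<close> from the origin.\<close>

lemma tail:
  assumes S: "10 \<le> S" and s: "S + 1 / 8 \<le> s"
  shows "Y S s = R S * sinh (\<beta> S) / cosh (s - len S - \<beta> S)"
    and "X S s = R S * cosh (s - len S) / cosh (s - len S - \<beta> S)"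
proof -
  have sb: "sinh (\<beta> S) > 0" using mirror(2)[OF S] by simp
  have a: "v S t = - (t - len S - \<beta> S)" if "S + 1 / 8 \<le> t" for t
    using v_tail[OF that] S by (simp add: len_def)
  have "\<exists>c. \<forall>x\<in>{S + 1 / 8..}. Y S x * cosh (x - len S - \<beta> S) = c"
  proof (rule has_field_derivative_zero_constant)
    fix x assume x: "x \<in> {S + 1 / 8..}"
    have "((\<lambda>x. Y S x * cosh (x - len S - \<beta> S)) has_real_derivative
        Y S x * tanh (v S x) * cosh (x - len S - \<beta> S) + sinh (x - len S - \<beta> S) * Y S x) (at x)"
      by (auto intro!: derivative_eq_intros Y_has_derivative)
    moreover have "tanh (v S x) * cosh (x - len S - \<beta> S) = - sinh (x - len S - \<beta> S)"
      using x by (simp only: atLeast_iff a tanh_def cosh_minus sinh_minus) simp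
    ultimately have "((\<lambda>x. Y S x * cosh (x - len S - \<beta> S)) has_real_derivative 0) (at x)"
      by (simp add: mult.assoc mult.commute)
    then show "((\<lambda>x. Y S x * cosh (x - len S - \<beta> S)) has_real_derivative 0) (at x within {S + 1 / 8..})"
      by (rule DERIV_subset) simp
  qed simp
  then have "Y S t * cosh (t - len S - \<beta> S)
      = Y S (S + 1 / 8) * cosh (S + 1 / 8 - len S - \<beta> S)" if "S + 1 / 8 \<le> t" for t
    using that by (metis atLeast_iff order_refl)
  \<comment> \<open>The constant is evaluated at the end of the transition; \<open>R S\<close> is
    defined so that it equals \<open>R S * sinh (\<beta> S)\<close>.\<close>
  moreover have w: "S + 1 / 8 - len S - \<beta> S = - w S" by (simp add: len_def)
  ultimately have Yt: "Y S t = R S * sinh (\<beta> S) / cosh (t - len S - \<beta> S)" if "S + 1 / 8 \<le> t" for t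
    using sb that by (simp add: R_def divide_simps)
  then show "Y S s = R S * sinh (\<beta> S) / cosh (s - len S - \<beta> S)" using s .
  let ?F = "\<lambda>x. R S * cosh (x - len S) / cosh (x - len S - \<beta> S)"
  have "\<exists>c. \<forall>x\<in>{S + 1 / 8..}. X S x - ?F x = c"
  proof (rule has_field_derivative_zero_constant)
    fix x assume x: "x \<in> {S + 1 / 8..}"
    let ?c = "cosh (x - len S - \<beta> S)" and ?s = "sinh (x - len S - \<beta> S)"
    have dF: "(?F has_real_derivative
        (R S * sinh (x - len S) * ?c - R S * cosh (x - len S) * ?s) / (?c * ?c)) (at x)"
      by (auto intro!: derivative_eq_intros)
    have "sinh (\<beta> S) = sinh ((x - len S) - (x - len S - \<beta> S))" by simp
    also have "\<dots> = sinh (x - len S) * ?c - cosh (x - len S) * ?s"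
      by (rule sinh_diff)
    finally have sb: "sinh (\<beta> S) = sinh (x - len S) * ?c - cosh (x - len S) * ?s" .
    have "Y S x / cosh (v S x) = R S * (sinh (x - len S) * ?c - cosh (x - len S) * ?s) / ?c / ?c"
      using Yt[of x] a[of x] x sb by (metis atLeast_iff cosh_minus)
    also have "\<dots> = (R S * sinh (x - len S) * ?c - R S * cosh (x - len S) * ?s) / (?c * ?c)"
      by (simp add: algebra_simps)
    finally show "((\<lambda>x. X S x - ?F x) has_real_derivative 0) (at x within {S + 1 / 8..})"
      using DERIV_subset[OF DERIV_diff[OF X_has_derivative[of S x] dF], of "{S + 1 / 8..}"] by simp
  qed simp
  then have "X S s - ?F s = X S (S + 1 / 8) - ?F (S + 1 / 8)"
    using s by (metis atLeast_iff order_refl)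
  \<comment> \<open>The equation defining \<open>\<beta> S\<close> makes the constant of integration
    for \<open>X\<close> vanish, which centres the mirror circle at the origin.\<close>
  also have "\<dots> = 0"
  proof -
    have e: "S + 1 / 8 - len S = \<beta> S - w S" by (simp add: len_def)
    have "?F (S + 1 / 8) = R S * (q S * sinh (\<beta> S)) / cosh (w S)"
      unfolding e mirror(4)[OF S] by simp
    also have "\<dots> = X S (S + 1 / 8)"
      using sb Y_pos[of S "S + 1 / 8"] by (simp add: R_def q_def)
    finally show ?thesis by simp
  qed
  finally show "X S s = ?F s" by simp
qed

text \<open>The mirror circle is orthogonal to the geodesic, so inversion maps the geodesic to
  itself and reverses it about \<open>len S\<close>. In formulas, the squared modulus at
  \<open>t\<close> is \<open>R\<^sup>2 * cosh (\<tau> - \<beta>) / cosh (\<tau> + \<beta>)\<close>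
  with \<open>\<tau> = s - len S\<close>, and dividing by it exchanges the two denominators.\<close>

lemma reflection:
  assumes S: "10 \<le> S" and s: "S + 1 / 8 \<le> s" "S + 1 / 8 \<le> 2 * len S - s"
  defines "t \<equiv> 2 * len S - s"
  shows "(R S)\<^sup>2 * X S t / ((X S t)\<^sup>2 + (Y S t)\<^sup>2) = X S s"
    and "(R S)\<^sup>2 * Y S t / ((X S t)\<^sup>2 + (Y S t)\<^sup>2) = Y S s"
proof -
  let ?\<tau> = "s - len S"
  have ne: "R S \<noteq> 0" using R_pos[OF S] by simp
  have c1: "cosh (t - len S) = cosh ?\<tau>" using cosh_minus[of ?\<tau>] by (simp add: t_def)
  have c2: "cosh (t - len S - \<beta> S) = cosh (?\<tau> + \<beta> S)"
    using cosh_minus[of "?\<tau> + \<beta> S"] by (simp add: t_def algebra_simps)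
  have Xt: "X S t = R S * cosh ?\<tau> / cosh (?\<tau> + \<beta> S)"
    and Yt: "Y S t = R S * sinh (\<beta> S) / cosh (?\<tau> + \<beta> S)"
    using tail[OF S, of t] s(2) unfolding t_def[symmetric] c1 c2 by auto
  have "(X S t)\<^sup>2 + (Y S t)\<^sup>2
      = (R S)\<^sup>2 * ((cosh ?\<tau>)\<^sup>2 + (sinh (\<beta> S))\<^sup>2) / (cosh (?\<tau> + \<beta> S))\<^sup>2"
    unfolding Xt Yt by (simp add: power_divide power_mult_distrib algebra_simps add_divide_distrib)
  also have "\<dots> = (R S)\<^sup>2 * cosh (?\<tau> - \<beta> S) / cosh (?\<tau> + \<beta> S)"
    unfolding cosh_sq_plus_sinh_sq by (simp add: power2_eq_square)
  finally have N: "(X S t)\<^sup>2 + (Y S t)\<^sup>2 = (R S)\<^sup>2 * cosh (?\<tau> - \<beta> S) / cosh (?\<tau> + \<beta> S)" .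
  show "(R S)\<^sup>2 * X S t / ((X S t)\<^sup>2 + (Y S t)\<^sup>2) = X S s"
    unfolding N tail(2)[OF S s(1)] unfolding Xt using ne by simp
  show "(R S)\<^sup>2 * Y S t / ((X S t)\<^sup>2 + (Y S t)\<^sup>2) = Y S s"
    unfolding N tail(1)[OF S s(1)] unfolding Yt using ne by simp
qed

section \<open>Continuity of the length in \<open>S\<close>, and the lengths attained\<close>

lemma continuous_v: "continuous_on UNIV (\<lambda>(S, s). v S s)"
proof -
  have c: "continuous_on UNIV Phi" by (rule smooth_curve_imp_continuous[OF smooth_Phi])
  show ?thesis
    unfolding v_def case_prod_beta
    by (intro continuous_intros continuous_on_compose2[OF c]) auto
qed

lemma continuous_Y: "continuous_on UNIV (\<lambda>(S, s). Y S s)"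
proof -
  have "continuous_on UNIV (\<lambda>(S, s). primitive (\<lambda>s. tanh (v S s)) s)"
    using continuous_v unfolding case_prod_beta
    by (intro continuous_on_primitive[unfolded case_prod_beta] continuous_intros) auto
  then show ?thesis unfolding Y_def case_prod_beta by (intro continuous_intros)
qed

lemma continuous_X: "continuous_on UNIV (\<lambda>(S, s). X S s)"
  using continuous_v continuous_Y unfolding X_def case_prod_beta
  by (intro continuous_on_primitive[unfolded case_prod_beta] continuous_intros) auto

lemma continuous_len: "continuous_on {10..} len"
proof -
  have c: "continuous_on A (\<lambda>S. f S (S + 1 / 8))" if "continuous_on UNIV (\<lambda>(S, s). f S s)"
    for f :: "real \<Rightarrow> real \<Rightarrow> real" and A
  proof -
    have "continuous_on A (\<lambda>S. (S, S + 1 / 8))" by (intro continuous_intros)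
    from continuous_on_compose2[OF that this] show ?thesis by simp
  qed
  have w: "continuous_on {10..} w" unfolding w_def[abs_def] by (rule c[OF continuous_v])
  have q: "continuous_on {10..} q" unfolding q_def[abs_def]
    by (intro continuous_on_divide c[OF continuous_X] c[OF continuous_Y]) (simp add: Y_pos less_imp_neq[symmetric])
  have pos: "q S - exp (- w S) > 0" "q S + exp (w S) > 0" if "10 \<le> S" for S
    using mirror(1)[OF that] exp_gt_zero[of "w S"] exp_gt_zero[of "- w S"] by linarith+
  show ?thesis
    unfolding len_def[abs_def] \<beta>_def mirror_shift_def
    by (intro continuous_intros w q) (use pos in \<open>force\<close>)+
qed

lemma len_surj:
  assumes "len 10 \<le> l"
  obtains S where "10 \<le> S" "len S = l"
proof -
  have l: "10 \<le> l" using assms less_len[of 10] by simp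
  \<comment> \<open>The value \<open>l\<close> itself serves as upper end of the bracket, because
    \<open>len l > l\<close>.\<close>
  have "\<exists>S\<ge>10. S \<le> l \<and> len S = l"
    by (rule IVT') (use assms l less_len[OF l] continuous_on_subset[OF continuous_len] in auto)
  then show ?thesis using that by blast
qed

end

section \<open>Closing up the profile curve\<close>

text \<open>The \<open>4 l\<close>-periodic function equal to \<open>f\<close> on \<open>[-l, l]\<close> and to \<open>g\<close> on \<open>(l, 3 l)\<close>.\<close>

definition glue :: "real \<Rightarrow> (real \<Rightarrow> 'a) \<Rightarrow> (real \<Rightarrow> 'a) \<Rightarrow> real \<Rightarrow> 'a" where
  "glue l f g s = (let r = s - 4 * l * \<lfloor>(s + l) / (4 * l)\<rfloor> in if r \<le> l then f r else g r)"

lemma glue_eq: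
  assumes "l > 0" "- l \<le> s - 4 * l * of_int n" "s - 4 * l * of_int n < 3 * l"
  shows "glue l f g s = (if s - 4 * l * of_int n \<le> l then f (s - 4 * l * of_int n) else g (s - 4 * l * of_int n))"
proof -
  have "\<lfloor>(s + l) / (4 * l)\<rfloor> = n"
    using assms by (intro floor_unique) (auto simp: field_simps)
  then show ?thesis by (simp add: glue_def Let_def)
qed

lemma glue_periodic:
  assumes "l > 0" shows "glue l f g (s + 4 * l) = glue l f g s"
proof -
  have "(s + 4 * l + l) / (4 * l) = (s + l) / (4 * l) + 1" using assms by (simp add: field_simps)
  then have "\<lfloor>(s + 4 * l + l) / (4 * l)\<rfloor> = \<lfloor>(s + l) / (4 * l)\<rfloor> + 1" by simp
  then show ?thesis unfolding glue_def Let_def by (simp add: algebra_simps)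
qed

text \<open>Both seams fall under the closed case \<open>left\<close>, so matching of the two pieces
  enters only through \<open>glue_left\<close>.\<close>

lemma glue_cases:
  fixes l s :: real
  assumes "l > 0"
  obtains (left) n :: int where "- l \<le> s - 4 * l * n" "s - 4 * l * n \<le> l"
    | (right) n :: int where "l < s - 4 * l * n" "s - 4 * l * n < 3 * l"
proof -
  define n where "n = \<lfloor>(s + l) / (4 * l)\<rfloor>"
  have "real_of_int n \<le> (s + l) / (4 * l)" "(s + l) / (4 * l) < real_of_int n + 1"
    unfolding n_def by linarith+
  then have "- l \<le> s - 4 * l * n" "s - 4 * l * n < 3 * l"
    using assms by (auto simp: field_simps)
  then show ?thesis using left[of n] right[of n] by linarith
qed

lemma glue_right:
  assumes "l > 0" "l < s - 4 * l * of_int n" "s - 4 * l * of_int n < 3 * l"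
  shows "\<forall>\<^sub>F t in nhds s. glue l f g t = g (t - 4 * l * of_int n)"
proof -
  have "\<forall>\<^sub>F t in nhds s. t \<in> {l + 4 * l * of_int n <..< 3 * l + 4 * l * of_int n}"
    using assms by (intro eventually_nhds_in_open) auto
  then show ?thesis
  proof (rule eventually_mono)
    fix t assume "t \<in> {l + 4 * l * of_int n <..< 3 * l + 4 * l * of_int n}"
    then show "glue l f g t = g (t - 4 * l * of_int n)"
      using assms(1) by (subst glue_eq[of l t n]) auto
  qed
qed

text \<open>Agreement of \<open>f\<close> and \<open>g\<close> near the seams lets \<open>f\<close>
  describe the glued function slightly beyond both ends of its interval. At the left end the
  comparison is with \<open>g\<close> one period later.\<close>

lemma glue_left:
  assumes "l > 0" "- l \<le> s - 4 * l * of_int n" "s - 4 * l * of_int n \<le> l"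
    and \<eta>: "\<eta> > 0" "\<And>t. \<bar>t - l\<bar> < \<eta> \<Longrightarrow> f t = g t" "\<And>t. \<bar>t + l\<bar> < \<eta> \<Longrightarrow> f t = g (t + 4 * l)"
  shows "\<forall>\<^sub>F t in nhds s. glue l f g t = f (t - 4 * l * of_int n)"
proof -
  \<comment> \<open>The bound \<open>2 * l\<close> is the length of the interval on which
    \<open>g\<close> is used, so the neighbourhood does not run past it.\<close>
  define e where "e = min \<eta> (2 * l)"
  have e: "e > 0" "e \<le> \<eta>" "e \<le> 2 * l" using assms by (auto simp: e_def)
  have "\<forall>\<^sub>F t in nhds s. t \<in> {- l - e + 4 * l * of_int n <..< l + e + 4 * l * of_int n}"
    using assms e by (intro eventually_nhds_in_open) auto
  then show ?thesis
  proof (rule eventually_mono)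
    fix t assume t: "t \<in> {- l - e + 4 * l * of_int n <..< l + e + 4 * l * of_int n}"
    consider "- l \<le> t - 4 * l * n" "t - 4 * l * n \<le> l" | "l < t - 4 * l * n" | "t - 4 * l * n < - l"
      by linarith
    then show "glue l f g t = f (t - 4 * l * of_int n)"
    proof cases
      case 1 then show ?thesis using assms(1) by (subst glue_eq[of l t n]) auto
    next
      case 2 then show ?thesis
        using assms(1) t e \<eta>(2)[of "t - 4 * l * n"] by (subst glue_eq[of l t n]) auto
    next
      case 3
      \<comment> \<open>A point just before the left seam belongs to the period with index
        \<open>n - 1\<close>.\<close>
      have eq: "t - 4 * l * of_int (n - 1) = t - 4 * l * n + 4 * l" by (simp add: algebra_simps)
      have "glue l f g t = g (t - 4 * l * n + 4 * l)"
        unfolding eq[symmetric]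
        by (subst glue_eq[of l t "n - 1"]) (use 3 assms(1) t e in \<open>auto simp: algebra_simps\<close>)
      also have "\<dots> = f (t - 4 * l * n)"
        by (rule \<eta>(3)[symmetric]) (use 3 t e in auto)
      finally show ?thesis .
    qed
  qed
qed

text \<open>Two profile curves whose positions agree near both seams; agreement of tangents and
  curvatures is deduced from this.\<close>

context
  fixes l \<eta> X0 Y0 C0 N0 k0 X1 Y1 C1 N1 k1
  assumes l: "l > 0" and \<eta>: "\<eta> > 0"
    and P0: "\<And>s. profile_at X0 Y0 C0 N0 k0 s" and P1: "\<And>s. profile_at X1 Y1 C1 N1 k1 s"
    and near: "\<And>t. \<bar>t - l\<bar> < \<eta> \<Longrightarrow> X0 t = X1 t \<and> Y0 t = Y1 t"
      "\<And>t. \<bar>t + l\<bar> < \<eta> \<Longrightarrow> X0 t = X1 (t + 4 * l) \<and> Y0 t = Y1 (t + 4 * l)"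
begin

lemma ev_abs_less: "\<bar>t + c\<bar> < \<eta> \<Longrightarrow> (\<And>u. \<bar>u + c\<bar> < \<eta> \<Longrightarrow> P u) \<Longrightarrow> \<forall>\<^sub>F u in nhds t. P u"
  for c t :: real
proof -
  assume "\<bar>t + c\<bar> < \<eta>" and P: "\<And>u. \<bar>u + c\<bar> < \<eta> \<Longrightarrow> P u"
  then have "\<forall>\<^sub>F u in nhds t. u \<in> {- c - \<eta> <..< - c + \<eta>}"
    by (intro eventually_nhds_in_open) auto
  then show ?thesis by (rule eventually_mono) (auto intro!: P)
qed

lemma near_all_right: "C0 t = C1 t \<and> N0 t = N1 t \<and> k0 t = k1 t" if "\<bar>t - l\<bar> < \<eta>"
  by (rule profile_at_unique[OF P0 P1]) (rule ev_abs_less[of _ "- l"]; use that near(1) in simp)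

lemma near_all_left:
  "C0 t = C1 (t + 4 * l) \<and> N0 t = N1 (t + 4 * l) \<and> k0 t = k1 (t + 4 * l)" if "\<bar>t + l\<bar> < \<eta>"
  by (rule profile_at_unique[OF P0 profile_at_translate[OF P1]]) (rule ev_abs_less[of _ l]; use that near(2) in simp)

lemma glue_left_all:
  assumes "- l \<le> s - 4 * l * of_int n" "s - 4 * l * of_int n \<le> l"
  shows "\<forall>\<^sub>F t in nhds s. glue l X0 X1 t = X0 (t - 4 * l * of_int n)"
    "\<forall>\<^sub>F t in nhds s. glue l Y0 Y1 t = Y0 (t - 4 * l * of_int n)"
    "\<forall>\<^sub>F t in nhds s. glue l C0 C1 t = C0 (t - 4 * l * of_int n)"
    "\<forall>\<^sub>F t in nhds s. glue l N0 N1 t = N0 (t - 4 * l * of_int n)"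
    "\<forall>\<^sub>F t in nhds s. glue l k0 k1 t = k0 (t - 4 * l * of_int n)"
  using near near_all_right near_all_left by (auto intro!: glue_left[OF l assms \<eta>])

lemma profile_at_glue:
  "profile_at (glue l X0 X1) (glue l Y0 Y1) (glue l C0 C1) (glue l N0 N1) (glue l k0 k1) s"
proof (rule glue_cases[OF l, of s])
  fix n :: int assume left: "- l \<le> s - 4 * l * n" "s - 4 * l * n \<le> l"
  from profile_at_translate[of X0 Y0 C0 N0 k0 s "- (4 * l * of_int n)", OF P0] show ?thesis
    by (rule profile_at_cong) (use glue_left_all[OF left] in \<open>auto elim: eventually_elim2 intro!: eventually_conj\<close>)
next
  fix n :: int assume right: "l < s - 4 * l * n" "s - 4 * l * n < 3 * l"
  from profile_at_translate[of X1 Y1 C1 N1 k1 s "- (4 * l * of_int n)", OF P1] show ?thesis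
    by (rule profile_at_cong) (auto intro!: eventually_conj glue_right[OF l right])
qed

lemma smooth_curve_glue:
  fixes f g :: "real \<Rightarrow> 'a::real_normed_vector"
  assumes "smooth_curve f" "smooth_curve g"
    and "\<And>t. \<bar>t - l\<bar> < \<eta> \<Longrightarrow> f t = g t" "\<And>t. \<bar>t + l\<bar> < \<eta> \<Longrightarrow> f t = g (t + 4 * l)"
  shows "smooth_curve (glue l f g)"
proof (rule smooth_curve_local)
  fix s
  have sh: "smooth_curve (\<lambda>t. h (t - 4 * l * of_int n))" if "smooth_curve h"
    for h :: "real \<Rightarrow> 'a" and n
    by (intro smooth_curve_compose[OF that] smooth_curve_intros)
  show "\<exists>h. smooth_curve h \<and> (\<forall>\<^sub>F t in nhds s. glue l f g t = h t)"
  proof (rule glue_cases[OF l, of s])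
    fix n :: int assume left: "- l \<le> s - 4 * l * n" "s - 4 * l * n \<le> l"
    have "\<forall>\<^sub>F t in nhds s. glue l f g t = f (t - 4 * l * of_int n)"
      by (rule glue_left[OF l left \<eta>]) (use assms in auto)
    then show ?thesis using sh[OF assms(1)] by blast
  next
    fix n :: int assume right: "l < s - 4 * l * n" "s - 4 * l * n < 3 * l"
    then show ?thesis using glue_right[OF l right] sh[OF assms(2)] by blast
  qed
qed

lemma smooth_curve_glue_XYk:
  assumes "smooth_curve X0" "smooth_curve X1" "smooth_curve Y0" "smooth_curve Y1"
    "smooth_curve k0" "smooth_curve k1"
  shows "smooth_curve (glue l X0 X1)" "smooth_curve (glue l Y0 Y1)" "smooth_curve (glue l k0 k1)"
  using assms near near_all_right near_all_left by (auto intro!: smooth_curve_glue)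

end

text \<open>The catenary profile fills \<open>[- l, l]\<close> with \<open>l = len S\<close>, and
  its inverse, traversed backwards, fills \<open>[l, 3 * l]\<close>. The four quarters have equal
  energy \<open>J S l < 4\<close>.\<close>

lemma closed_profile:
  obtains l0 :: real where "l0 > 0"
    "\<And>l. l \<ge> l0 \<Longrightarrow> \<exists>X Y C N k J. smooth_curve X \<and> smooth_curve Y \<and> smooth_curve k \<and>
      (\<forall>s. profile_at X Y C N k s \<and> X (s + 4 * l) = X s \<and> Y (s + 4 * l) = Y s \<and>
        N (s + 4 * l) = N s \<and> (J has_real_derivative (k s)\<^sup>2) (at s)) \<and>
      J (3 * l) - J (- l) < 16"
proof -
  obtain \<phi> :: "real \<Rightarrow> real" where phi: "smooth_curve \<phi>" "\<And>t. 0 \<le> \<phi> t" "\<And>t. \<phi> t \<le> 1"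
    "\<And>t. t \<le> 0 \<Longrightarrow> \<phi> t = 1" "\<And>t. 1 / 8 \<le> t \<Longrightarrow> \<phi> t = 0"
    using smooth_step_exists[of "1 / 8"] by auto
  interpret blend \<phi> using phi by unfold_locales auto
  have "\<exists>X Y C N k J. smooth_curve X \<and> smooth_curve Y \<and> smooth_curve k \<and>
      (\<forall>s. profile_at X Y C N k s \<and> X (s + 4 * l) = X s \<and> Y (s + 4 * l) = Y s \<and>
        N (s + 4 * l) = N s \<and> (J has_real_derivative (k s)\<^sup>2) (at s)) \<and>
      J (3 * l) - J (- l) < 16" if len_le: "len 10 \<le> l" for l
  proof -
    obtain S where S: "10 \<le> S" and l: "len S = l" using len_surj[OF len_le] .
    \<comment> \<open>Within this distance of \<open>l\<close> both \<open>s\<close> and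
      \<open>2 * l - s\<close> lie on the geodesic tail, where inversion acts as reversal.\<close>
    define \<eta> where "\<eta> = l - (S + 1 / 8)"
    have \<eta>: "\<eta> > 0" and l0: "l > 0" using less_len[OF S] S l by (auto simp: \<eta>_def)
    define X1 where "X1 s = (R S)\<^sup>2 * X S s / ((X S s)\<^sup>2 + (Y S s)\<^sup>2)" for s
    define Y1 where "Y1 s = (R S)\<^sup>2 * Y S s / ((X S s)\<^sup>2 + (Y S s)\<^sup>2)" for s
    have mirrored: "X1 (2 * l - s) = X S s" "Y1 (2 * l - s) = Y S s" if "\<bar>s - l\<bar> < \<eta>" for s
      using reflection[OF S, of s] that unfolding X1_def Y1_def l \<eta>_def by auto
    have X1_odd: "X1 (- s) = - X1 s" and Y1_even: "Y1 (- s) = Y1 s" for s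
      by (simp_all add: X1_def Y1_def X_odd Y_even)
    note inv = profile_at_reflect[OF profile_at_invert[OF profile[of S] R_pos[OF S]], folded X1_def Y1_def, where p = "2 * l"]
    have sm: "smooth_curve X1" "smooth_curve Y1"
      unfolding X1_def Y1_def power2_eq_square
      by (intro smooth_curve_intros smooth_X smooth_Y; use Y_pos[of S] in \<open>auto simp: sum_squares_eq_zero_iff less_le\<close>)+
    have near: "X S t = X1 (2 * l - t) \<and> Y S t = Y1 (2 * l - t)" if "\<bar>t - l\<bar> < \<eta>" for t
      using mirrored[OF that] by simp
    have near': "X S t = X1 (2 * l - (t + 4 * l)) \<and> Y S t = Y1 (2 * l - (t + 4 * l))"
      if "\<bar>t + l\<bar> < \<eta>" for t
    proof -
      \<comment> \<open>The symmetry \<open>X\<close> to \<open>-X\<close> commutes with the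
        inversion and carries the seam at \<open>l\<close> to the seam at \<open>-l\<close>.\<close>
      have "\<bar>- t - l\<bar> < \<eta>" using that by linarith
      from mirrored[OF this] show ?thesis
        using X1_odd[of "2 * l - - t"] Y1_even[of "2 * l - - t"] by (simp add: X_odd Y_even)
    qed
    note g = l0 \<eta> profile[of S] inv near near'
    \<comment> \<open>One sign comes from the inversion and one from the reversal of direction, so
      the curvature continues without a change of sign.\<close>
    let ?k = "glue l (k S) (\<lambda>s. - (- k S (2 * l - s)))"
    have sm': "smooth_curve (\<lambda>s. X1 (2 * l - s))" "smooth_curve (\<lambda>s. Y1 (2 * l - s))"
      "smooth_curve (\<lambda>s. - (- k S (2 * l - s)))"
      using smooth_curve_diff[OF smooth_curve_const smooth_curve_id, of "2 * l"]
        smooth_curve_compose[OF sm(1), of "\<lambda>s. 2 * l - s"]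
        smooth_curve_compose[OF sm(2), of "\<lambda>s. 2 * l - s"]
        smooth_curve_compose[OF smooth_k[of S], of "\<lambda>s. 2 * l - s"]
      by simp_all
    note sk = smooth_curve_glue_XYk[OF g smooth_X sm'(1) smooth_Y sm'(2) smooth_k sm'(3)]
    define I where "I = primitive (\<lambda>s. (?k s)\<^sup>2)"
    have I: "(I has_real_derivative (?k s)\<^sup>2) (at s)" for s
      unfolding I_def power2_eq_square
      by (intro primitive_has_derivative smooth_curve_imp_continuous smooth_curve_mult sk)
    have kl: "?k s = k S s" if "- l \<le> s" "s \<le> l" for s
      using glue_eq[of l s 0] that l0 by simp
    have kr: "?k s = k S (2 * l - s)" if "l \<le> s" "s \<le> 3 * l" for s
    proof (cases "s = l \<or> s = 3 * l")
      case True
      then show ?thesis using kl[of l] kl[of "- l"] glue_periodic[OF l0, of "k S" "\<lambda>s. - (- k S (2 * l - s))" "- l"] l0 by auto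
    next
      case False
      then show ?thesis using glue_eq[of l s 0] that l0 by auto
    qed
    \<comment> \<open>The energy is computed on the two halves: \<open>I\<close> follows
      \<open>J S\<close> on the first, and \<open>J S\<close> run backwards on the second. Each
      contributes \<open>J S l - J S (- l)\<close>, which is \<open>2 * J S l\<close> by
      oddness.\<close>
    have "\<exists>c. \<forall>x\<in>{- l..l}. I x - J S x = c"
    proof (rule has_field_derivative_zero_constant)
      fix x assume "x \<in> {- l..l}"
      then show "((\<lambda>x. I x - J S x) has_real_derivative 0) (at x within {- l..l})"
        using DERIV_subset[OF DERIV_diff[OF I[of x] J_has_derivative[of S x]], of "{- l..l}"] kl[of x] by simp
    qed simp
    then obtain c where "\<forall>x\<in>{- l..l}. I x - J S x = c" ..
    from bspec[OF this, of l] bspec[OF this, of "- l"]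
    have 1: "I l - J S l = I (- l) - J S (- l)" using l0 by simp
    have "\<exists>c. \<forall>x\<in>{l..3 * l}. I x + J S (2 * l - x) = c"
    proof (rule has_field_derivative_zero_constant)
      fix x assume x: "x \<in> {l..3 * l}"
      have "((\<lambda>x. I x + J S (2 * l - x)) has_real_derivative
          (?k x)\<^sup>2 + (k S (2 * l - x))\<^sup>2 * (0 - 1)) (at x)"
        by (intro DERIV_add I DERIV_chain2[OF J_has_derivative] DERIV_diff DERIV_const DERIV_ident)
      then show "((\<lambda>x. I x + J S (2 * l - x)) has_real_derivative 0) (at x within {l..3 * l})"
        using kr[of x] x DERIV_subset[of _ _ x UNIV "{l..3 * l}"] by simp
    qed simp
    then obtain c where "\<forall>x\<in>{l..3 * l}. I x + J S (2 * l - x) = c" ..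
    from bspec[OF this, of l] bspec[OF this, of "3 * l"]
    have "I l + J S (2 * l - l) = I (3 * l) + J S (2 * l - 3 * l)" using l0 by simp
    then have 2: "I l + J S l = I (3 * l) + J S (- l)" by (simp add: algebra_simps)
    have "J S l < 4" using J_less_4[of S l] S less_len[OF S] l by simp
    then have "I (3 * l) - I (- l) < 16" using 1 2 J_odd[of S l] by linarith
    then show ?thesis
      using sk profile_at_glue[OF g] glue_periodic[OF l0] I by blast
  qed
  moreover have "len 10 > 0" using less_len[of 10] by simp
  ultimately show ?thesis using that by blast
qed

section \<open>Surfaces of revolution\<close>

text \<open>The coefficients are arbitrary vector-valued curves, which makes this form closed under
  directional derivatives; smoothness then follows by induction.\<close>

definition rot_map ::
  "(real \<Rightarrow> 'a) \<Rightarrow> (real \<Rightarrow> 'a) \<Rightarrow> (real \<Rightarrow> 'a) \<Rightarrow> complex \<Rightarrow> 'a::real_normed_vector" where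
  "rot_map A B C z = A (Im z) + cos (2 * pi * Re z) *\<^sub>R B (Im z) + sin (2 * pi * Re z) *\<^sub>R C (Im z)"

lemma rot_map_has_derivative:
  assumes "\<And>s. (A has_vector_derivative A' s) (at s)" "\<And>s. (B has_vector_derivative B' s) (at s)"
    "\<And>s. (C has_vector_derivative C' s) (at s)"
  shows "(rot_map A B C has_derivative
    (\<lambda>v. rot_map (\<lambda>s. Im v *\<^sub>R A' s)
      (\<lambda>s. Im v *\<^sub>R B' s + (2 * pi * Re v) *\<^sub>R C s)
      (\<lambda>s. Im v *\<^sub>R C' s - (2 * pi * Re v) *\<^sub>R B s) z)) (at z)"
proof -
  have Im: "((\<lambda>z. F (Im z)) has_derivative (\<lambda>v. Im v *\<^sub>R F' (Im z))) (at z)"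
    if "\<And>s. (F has_vector_derivative F' s) (at s)" for F F' :: "real \<Rightarrow> 'a"
    using has_derivative_compose[OF bounded_linear.has_derivative[OF bounded_linear_Im has_derivative_ident]
        that[unfolded has_vector_derivative_def]] .
  have "((\<lambda>z. A (Im z) + cos (2 * pi * Re z) *\<^sub>R B (Im z) + sin (2 * pi * Re z) *\<^sub>R C (Im z))
     has_derivative (\<lambda>v. Im v *\<^sub>R A' (Im z)
       + (cos (2 * pi * Re z) *\<^sub>R (Im v *\<^sub>R B' (Im z)) + (- sin (2 * pi * Re z) * (2 * pi * Re v)) *\<^sub>R B (Im z))
       + (sin (2 * pi * Re z) *\<^sub>R (Im v *\<^sub>R C' (Im z)) + (cos (2 * pi * Re z) * (2 * pi * Re v)) *\<^sub>R C (Im z)))) (at z)"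
    by (intro has_derivative_add has_derivative_scaleR Im assms)
       (auto intro!: derivative_eq_intros bounded_linear.has_derivative[OF bounded_linear_Re])
  then show ?thesis
    unfolding rot_map_def[abs_def]
    by (rule has_derivative_eq_rhs) (simp add: fun_eq_iff algebra_simps)
qed

lemma dir_deriv_rot_map:
  assumes "\<And>s. (A has_vector_derivative A' s) (at s)" "\<And>s. (B has_vector_derivative B' s) (at s)"
    "\<And>s. (C has_vector_derivative C' s) (at s)"
  shows "dir_deriv (rot_map A B C) v = rot_map (\<lambda>s. Im v *\<^sub>R A' s)
      (\<lambda>s. Im v *\<^sub>R B' s + (2 * pi * Re v) *\<^sub>R C s)
      (\<lambda>s. Im v *\<^sub>R C' s - (2 * pi * Re v) *\<^sub>R B s)"
  by (rule ext) (simp only: frechet_derivative_at[OF rot_map_has_derivative[OF assms], symmetric])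

lemma smooth_rot_map:
  assumes "smooth_curve A" "smooth_curve B" "smooth_curve C"
  shows "smooth (rot_map A B C)"
proof -
  have "Ck n (rot_map A B C)" if "smooth_curve A" "smooth_curve B" "smooth_curve C" for n A B C
    using that
  proof (induction n arbitrary: A B C)
    case 0
    obtain A' B' C' where d: "\<And>s. (A has_vector_derivative A' s) (at s)"
      "\<And>s. (B has_vector_derivative B' s) (at s)" "\<And>s. (C has_vector_derivative C' s) (at s)"
      using 0 by (meson smooth_curve_derivative)
    show ?case
      using has_derivative_continuous[OF rot_map_has_derivative[OF d]]
      by (simp add: continuous_at_imp_continuous_on)
  next
    case (Suc n)
    obtain A' B' C' where d: "\<And>s. (A has_vector_derivative A' s) (at s)" "smooth_curve A'"
      "\<And>s. (B has_vector_derivative B' s) (at s)" "smooth_curve B'"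
      "\<And>s. (C has_vector_derivative C' s) (at s)" "smooth_curve C'"
      using Suc.prems by (meson smooth_curve_derivative)
    have "rot_map A B C differentiable (at z)" for z
      using rot_map_has_derivative[OF d(1,3,5)] by (auto simp: differentiable_def)
    then show ?case
      unfolding Ck.simps dir_deriv_rot_map[OF d(1,3,5)]
      by (auto intro!: Suc.IH smooth_curve_intros d Suc.prems)
  qed
  from this[OF assms] show ?thesis by (simp add: smooth_def)
qed

text \<open>Fubini on a box of width one, for an integrand depending on the height only.\<close>

lemma nn_integral_complex_box:
  fixes h :: "real \<Rightarrow> ennreal"
  assumes [measurable]: "h \<in> borel_measurable borel"
  shows "(\<integral>\<^sup>+ z. h (Im z) * indicator {z. Re z \<in> {0..<1} \<and> Im z \<in> {0..<y}} z \<partial>lborel)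
    = (\<integral>\<^sup>+ t. h t * indicator {0..<y} t \<partial>lborel)"
proof -
  define F :: "complex \<Rightarrow> real \<Rightarrow> ennreal" where
    "F b = (if b = 1 then indicator {0..<1} else (\<lambda>t. h t * indicator {0..<y} t))" for b
  have prod: "(\<Prod>b\<in>Basis. G b) = G 1 * G \<i>" for G :: "complex \<Rightarrow> ennreal"
    by (simp add: Basis_complex_def)
  have F: "F 1 = indicator {0..<1}" "F \<i> = (\<lambda>t. h t * indicator {0..<y} t)"
    by (simp_all add: F_def)
  have F_measurable: "F b \<in> borel_measurable borel" for b
    by (cases "b = 1") (simp_all add: F_def)
  have "(\<integral>\<^sup>+ z. h (Im z) * indicator {z. Re z \<in> {0..<1} \<and> Im z \<in> {0..<y}} z \<partial>lborel)
      = (\<integral>\<^sup>+ z. (\<Prod>b\<in>Basis. F b (z \<bullet> b)) \<partial>lborel)"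
    unfolding prod F by (intro nn_integral_cong) (auto simp: indicator_def)
  also have "\<dots> = (\<Prod>b\<in>Basis. \<integral>\<^sup>+ t. F b t \<partial>lborel)"
    by (rule nn_integral_lborel_prod[OF F_measurable zero_le])
  also have "\<dots> = (\<integral>\<^sup>+ t. h t * indicator {0..<y} t \<partial>lborel)"
    unfolding prod F by (subst nn_integral_indicator) auto
  finally show ?thesis .
qed

lemma periodic_int:
  fixes f :: "real \<Rightarrow> 'a"
  assumes "\<And>s. f (s + p) = f s"
  shows "f (s + of_int n * p) = f s"
proof (induction n rule: int_induct[where k = 0])
  case (step1 i)
  then show ?case using assms[of "s + of_int i * p"] by (simp add: algebra_simps)
next
  case (step2 i)
  then show ?case using assms[of "s + of_int (i - 1) * p"] by (simp add: algebra_simps)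
qed simp

locale revolution =
  fixes X Y C N k :: "real \<Rightarrow> real" and l :: real
  assumes profile: "\<And>s. profile_at X Y C N k s"
    and smooth_X: "smooth_curve X" and smooth_Y: "smooth_curve Y"
begin

text \<open>Arc length \<open>2 * pi * t - l\<close> and rotation angle are both scaled by
  \<open>2 * pi\<close>, which makes \<open>f\<close> conformal. If
  \<open>4 * l = 2 * pi * y\<close>, then \<open>t\<close> from \<open>0\<close> to \<open>y\<close>
  covers \<open>[- l, 3 * l]\<close>.\<close>

definition "A t = X (2 * pi * t - l) *\<^sub>R (axis 1 1 :: real^3)"
definition "B t = Y (2 * pi * t - l) *\<^sub>R (axis 2 1 :: real^3)"
definition "D t = Y (2 * pi * t - l) *\<^sub>R (axis 3 1 :: real^3)"

definition "f = rot_map A B D"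

definition "arg z = 2 * pi * Im z - l"

text \<open>Coordinates in the orthonormal frame of axial, radial and angular directions. Inner and
  cross products can be computed in them as if no rotation were present.\<close>

definition "frame z a b c = (vector
  [a, b * cos (2 * pi * Re z) - c * sin (2 * pi * Re z), b * sin (2 * pi * Re z) + c * cos (2 * pi * Re z)] :: real^3)"

lemma inner_frame: "frame z a b c \<bullet> frame z a' b' c' = a * a' + b * b' + c * c'"
proof -
  have "(cos (2 * pi * Re z))\<^sup>2 + (sin (2 * pi * Re z))\<^sup>2 = 1" by simp
  then show ?thesis unfolding frame_def inner_vec_def sum_3 by (simp, algebra)
qed

lemma cross3_frame:
  "cross3 (frame z a b c) (frame z a' b' c') = frame z (b * c' - c * b') (c * a' - a * c') (a * b' - b * a')"
proof -
  define p q where "p = cos (2 * pi * Re z)" and "q = sin (2 * pi * Re z)"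
  have pq: "p\<^sup>2 + q\<^sup>2 = 1" by (simp add: p_def q_def)
  have "(b * p - c * q) * (b' * q + c' * p) - (b * q + c * p) * (b' * p - c' * q) = b * c' - c * b'"
    using pq by algebra
  then show ?thesis
    unfolding frame_def cross3_def vec_eq_iff forall_3 p_def[symmetric] q_def[symmetric]
    by (simp add: algebra_simps)
qed

lemma rot_map_frame:
  "rot_map (\<lambda>t. a t *\<^sub>R axis 1 1) (\<lambda>t. b t *\<^sub>R axis 2 1 + c t *\<^sub>R axis 3 1)
    (\<lambda>t. b t *\<^sub>R axis 3 1 - c t *\<^sub>R axis 2 1) z = frame z (a (Im z)) (b (Im z)) (c (Im z))"
  unfolding rot_map_def frame_def vec_eq_iff forall_3 by (simp add: axis_def algebra_simps)

lemma has_vector_derivative_axis: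
  assumes "\<And>s. (p has_real_derivative p' s) (at s)"
  shows "((\<lambda>t. p (2 * pi * t - l) *\<^sub>R (e :: real^3)) has_vector_derivative (2 * pi * p' (2 * pi * t - l)) *\<^sub>R e) (at t)"
proof -
  have "((\<lambda>t. p (2 * pi * t - l)) has_real_derivative p' (2 * pi * t - l) * (2 * pi * 1 - 0)) (at t)"
    by (intro DERIV_chain2[OF assms] DERIV_diff DERIV_cmult DERIV_ident DERIV_const)
  from has_vector_derivative_scaleR[OF this has_vector_derivative_const] show ?thesis
    by (simp add: mult.commute)
qed

lemma Y_pos: "Y s > 0" and CN: "(C s)\<^sup>2 + (N s)\<^sup>2 = 1"
  using profile[of s] by (auto simp: profile_at_def)

lemma deriv_YC: "((\<lambda>s. Y s * C s) has_real_derivative Y s * (N s * (2 * C s - k s))) (at s)"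
  and deriv_YN: "((\<lambda>s. Y s * N s) has_real_derivative Y s * ((N s)\<^sup>2 + C s * (k s - C s))) (at s)"
  using DERIV_mult[OF profile_atD(4)[OF profile] profile_atD(5)[OF profile]]
    DERIV_mult[OF profile_atD(4)[OF profile] profile_atD(6)[OF profile]]
  by (auto elim!: DERIV_cong simp: algebra_simps power2_eq_square)

text \<open>The derivative is kept in the form \<open>rot_map\<close> so that it can be
  differentiated again.\<close>

lemma f_v_rot_map:
  "dir_deriv f v = rot_map (\<lambda>t. (Im v * (2 * pi * (Y (2 * pi * t - l) * C (2 * pi * t - l)))) *\<^sub>R axis 1 1)
    (\<lambda>t. (Im v * (2 * pi * (Y (2 * pi * t - l) * N (2 * pi * t - l)))) *\<^sub>R axis 2 1
      + (2 * pi * Re v * Y (2 * pi * t - l)) *\<^sub>R axis 3 1)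
    (\<lambda>t. (Im v * (2 * pi * (Y (2 * pi * t - l) * N (2 * pi * t - l)))) *\<^sub>R axis 3 1
      - (2 * pi * Re v * Y (2 * pi * t - l)) *\<^sub>R axis 2 1)"
  unfolding f_def A_def[abs_def] B_def[abs_def] D_def[abs_def]
  by (subst dir_deriv_rot_map[OF has_vector_derivative_axis[OF profile_atD(3)[OF profile]]
        has_vector_derivative_axis[OF profile_atD(4)[OF profile]]
        has_vector_derivative_axis[OF profile_atD(4)[OF profile]]]) simp

lemma f_v: "dir_deriv f v z = (2 * pi * Y (arg z)) *\<^sub>R
    frame z (Im v * C (arg z)) (Im v * N (arg z)) (Re v)"
  unfolding fun_cong[OF f_v_rot_map] rot_map_frame arg_def
  by (simp add: frame_def vec_eq_iff forall_3 algebra_simps)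

lemma f_vw: "dir_deriv (dir_deriv f v) w z = (4 * pi\<^sup>2 * Y (arg z)) *\<^sub>R
    frame z (Im v * Im w * (N (arg z) * (2 * C (arg z) - k (arg z))))
      (Im v * Im w * ((N (arg z))\<^sup>2 + C (arg z) * (k (arg z) - C (arg z))) - Re v * Re w)
      ((Im v * Re w + Re v * Im w) * N (arg z))"
proof -
  let ?s = "\<lambda>t. 2 * pi * t - l"
  have 1: "((\<lambda>t. (Im v * (2 * pi * (Y (?s t) * C (?s t)))) *\<^sub>R (axis 1 1 :: real^3)) has_vector_derivative
      (2 * pi * (Im v * (2 * pi * (Y (?s t) * (N (?s t) * (2 * C (?s t) - k (?s t))))))) *\<^sub>R axis 1 1) (at t)" for t
    by (rule has_vector_derivative_axis) (intro DERIV_cmult deriv_YC)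
  have 2: "((\<lambda>t. (Im v * (2 * pi * (Y (?s t) * N (?s t)))) *\<^sub>R (e :: real^3)) has_vector_derivative
      (2 * pi * (Im v * (2 * pi * (Y (?s t) * ((N (?s t))\<^sup>2 + C (?s t) * (k (?s t) - C (?s t))))))) *\<^sub>R e) (at t)" for t e
    by (rule has_vector_derivative_axis) (intro DERIV_cmult deriv_YN)
  have 3: "((\<lambda>t. (2 * pi * Re v * Y (?s t)) *\<^sub>R (e :: real^3)) has_vector_derivative
      (2 * pi * (2 * pi * Re v * (Y (?s t) * N (?s t)))) *\<^sub>R e) (at t)" for t e
    by (rule has_vector_derivative_axis) (intro DERIV_cmult profile_atD(4)[OF profile])
  show ?thesis
    unfolding f_v_rot_map
    by (subst fun_cong[OF dir_deriv_rot_map[OF 1 has_vector_derivative_add[OF 2 3] has_vector_derivative_diff[OF 2 3]]])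
       (simp add: rot_map_def frame_def vec_eq_iff forall_3 axis_def arg_def algebra_simps power2_eq_square)
qed

section \<open>Curvature and Willmore energy of the surface\<close>

lemma first_ff_f: "first_ff f z v w = (2 * pi * Y (arg z))\<^sup>2 * (v \<bullet> w)"
proof -
  have "Im v * C (arg z) * (Im w * C (arg z)) + Im v * N (arg z) * (Im w * N (arg z)) + Re v * Re w
      = v \<bullet> w"
    using CN[of "arg z"] unfolding inner_complex_def by algebra
  then show ?thesis
    unfolding first_ff_def f_v by (simp add: inner_frame power2_eq_square)
qed

lemma unit_normal_f: "unit_normal f z = frame z (- N (arg z)) (C (arg z)) 0"
proof -
  have "cross3 (dir_deriv f 1 z) (dir_deriv f \<i> z)
      = (2 * pi * Y (arg z))\<^sup>2 *\<^sub>R frame z (- N (arg z)) (C (arg z)) 0"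
    unfolding f_v by (simp add: cross_mult_left cross_mult_right cross3_frame power2_eq_square)
  moreover have "norm (frame z (- N (arg z)) (C (arg z)) 0) = 1"
    using CN[of "arg z"] unfolding norm_eq_1 inner_frame by (simp add: power2_eq_square)
  ultimately show ?thesis
    using Y_pos[of "arg z"] by (simp add: unit_normal_def sgn_div_norm)
qed

lemma second_ff_f: "second_ff f z v w = 4 * pi\<^sup>2 * Y (arg z) *
    (Im v * Im w * (k (arg z) - C (arg z)) - Re v * Re w * C (arg z))"
  unfolding second_ff_def f_vw unit_normal_f inner_scaleR_left inner_frame
  using CN[of "arg z"] by algebra

text \<open>Both fundamental forms are diagonal in the directions \<open>\<i>\<close> of the
  meridian and \<open>1\<close> of the parallel; these are the two ratios of diagonal
  entries.\<close>

lemma principal_curvatures_f: "principal_curvatures f z =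
    {(k (arg z) - C (arg z)) / Y (arg z), - C (arg z) / Y (arg z)}"
proof -
  define y m c where "y = Y (arg z)" and "m = k (arg z) - C (arg z)" and "c = C (arg z)"
  have y: "y > 0" using Y_pos by (simp add: y_def)
  have eq: "second_ff f z v w = \<kappa> * first_ff f z v w \<longleftrightarrow>
      Im v * Im w * (m - \<kappa> * y) = Re v * Re w * (c + \<kappa> * y)" for v w \<kappa>
  proof -
    have "second_ff f z v w - \<kappa> * first_ff f z v w
        = 4 * pi\<^sup>2 * y * (Im v * Im w * (m - \<kappa> * y) - Re v * Re w * (c + \<kappa> * y))"
      unfolding second_ff_f first_ff_f inner_complex_def y_def m_def c_def
      by (simp add: algebra_simps power2_eq_square)
    then show ?thesis using y by auto
  qed
  have "\<kappa> = m / y \<or> \<kappa> = - c / y"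
    if "v \<noteq> 0" "\<And>w. Im v * Im w * (m - \<kappa> * y) = Re v * Re w * (c + \<kappa> * y)" for v \<kappa>
  proof -
    have "Re v * (c + \<kappa> * y) = 0" "Im v * (m - \<kappa> * y) = 0"
      using that(2)[of 1] that(2)[of \<i>] by auto
    then have "c + \<kappa> * y = 0 \<or> m - \<kappa> * y = 0"
      using that(1) by (auto simp: complex_eq_iff)
    then show ?thesis using y by (auto simp: field_simps)
  qed
  then have "principal_curvatures f z \<subseteq> {m / y, - c / y}"
    unfolding principal_curvatures_def eq by auto
  moreover have "m / y \<in> principal_curvatures f z"
    unfolding principal_curvatures_def mem_Collect_eq eq by (rule exI[of _ \<i>]) (use y in simp)
  moreover have "- c / y \<in> principal_curvatures f z"
    unfolding principal_curvatures_def mem_Collect_eq eq by (rule exI[of _ 1]) (use y in simp)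
  ultimately have "principal_curvatures f z = {m / y, - c / y}" by blast
  then show ?thesis by (simp only: y_def m_def c_def)
qed

lemma mean_curvature_f: "mean_curvature f z = (k (arg z) - 2 * C (arg z)) / (2 * Y (arg z))"
proof -
  \<comment> \<open>This also covers umbilic points, where the two curvatures coincide.\<close>
  have "Min {a, b} + Max {a, b} = a + b" for a b :: real by (simp add: min_def max_def)
  then show ?thesis
    unfolding mean_curvature_def principal_curvatures_f by (simp add: diff_divide_distrib)
qed

lemma smooth_f: "smooth f"
  unfolding f_def A_def[abs_def] B_def[abs_def] D_def[abs_def]
  by (intro smooth_rot_map smooth_curve_intros smooth_curve_compose[OF smooth_X] smooth_curve_compose[OF smooth_Y])

lemma conformal_immersion_f:
  assumes per: "\<And>s. X (s + 2 * pi * y) = X s" "\<And>s. Y (s + 2 * pi * y) = Y s"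
  shows "conformal_immersion (Complex 0 y) f"
proof -
  have "f (z + (of_int m + of_int n * Complex 0 y)) = f z" for z m n
  proof -
    have p: "g (2 * pi * (Im z + of_int n * y) - l) = g (2 * pi * Im z - l)"
      if "\<And>s. g (s + 2 * pi * y) = g s" for g :: "real \<Rightarrow> real"
      using periodic_int[of g "2 * pi * y" "2 * pi * Im z - l" n, OF that] by (simp add: algebra_simps)
    have "2 * pi * (Re z + of_int m) = 2 * pi * Re z + 2 * pi * of_int m" by (simp add: algebra_simps)
    then have "cos (2 * pi * (Re z + of_int m)) = cos (2 * pi * Re z)"
      "sin (2 * pi * (Re z + of_int m)) = sin (2 * pi * Re z)"
      by (simp_all add: cos_add sin_add)
    then show ?thesis
      using p[of X, OF per(1)] p[of Y, OF per(2)]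
      by (simp add: f_def rot_map_def A_def B_def D_def)
  qed
  moreover have "\<exists>c>0. \<forall>v w. first_ff f z v w = c * (v \<bullet> w)" for z
    using Y_pos[of "arg z"] by (intro exI[of _ "(2 * pi * Y (arg z))\<^sup>2"]) (simp add: first_ff_f)
  ultimately show ?thesis
    unfolding conformal_immersion_def torus_map_def lattice_def using smooth_f by auto
qed

lemma continuous_C: "continuous_on UNIV C"
  using DERIV_isCont[OF profile_atD(5)[OF profile]]
  by (auto simp: continuous_on_eq_continuous_at)

text \<open>The conformal factor cancels the denominator of the squared mean curvature and leaves
  \<open>pi\<^sup>2 * (k - 2 * C)\<^sup>2\<close>. Here
  \<open>(k - 2 * C)\<^sup>2 = k\<^sup>2 - 4 * C * (k - C)\<close>, and \<open>C * (k - C)\<close>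
  is the derivative of \<open>N\<close>, so it integrates to zero over a period.\<close>

lemma willmore_f:
  assumes k: "continuous_on UNIV k" and y: "y > 0"
    and J: "\<And>s. (J has_real_derivative (k s)\<^sup>2) (at s)"
    and per: "\<And>s. N (s + 2 * pi * y) = N s"
  shows "willmore (Complex 0 y) f = ennreal (pi / 2 * (J (2 * pi * y - l) - J (- l)))"
proof -
  define h where "h t = pi\<^sup>2 * (k (2 * pi * t - l) - 2 * C (2 * pi * t - l))\<^sup>2" for t
  have [measurable]: "(\<lambda>t. X (2 * pi * t - l)) \<in> borel_measurable borel"
    if "continuous_on UNIV X" for X :: "real \<Rightarrow> real"
    by (intro borel_measurable_continuous_onI continuous_on_compose2[OF that] continuous_intros) auto
  note [measurable] = this[OF k] this[OF continuous_C] this[OF smooth_curve_imp_continuous[OF smooth_Y]]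
  have [measurable]: "Im \<in> borel_measurable borel" "Re \<in> borel_measurable borel"
    by (intro borel_measurable_continuous_onI continuous_intros)+
  have [measurable]: "h \<in> borel_measurable borel" unfolding h_def by measurable
  have fund: "fundamental_parallelogram (Complex 0 y) = {z. Re z \<in> {0..<1} \<and> Im z \<in> {0..<y}}"
  proof (intro set_eqI iffI)
    fix z assume "z \<in> {z. Re z \<in> {0..<1} \<and> Im z \<in> {0..<y}}"
    then show "z \<in> fundamental_parallelogram (Complex 0 y)"
      using y unfolding fundamental_parallelogram_def
      by (auto intro!: exI[of _ "Re z"] exI[of _ "Im z / y"] simp: complex_eq_iff)
  qed (use y in \<open>auto simp: fundamental_parallelogram_def\<close>)
  have Ym: "(\<lambda>z. Y (arg z)) \<in> borel_measurable borel"
    unfolding arg_def by measurable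
  have Hm: "(\<lambda>z. (k (arg z) - 2 * C (arg z)) / (2 * Y (arg z))) \<in> borel_measurable borel"
    unfolding arg_def by measurable
  note [measurable] = Ym Hm
  have sqrt4: "sqrt (x ^ 4) = x\<^sup>2" for x :: real
    by (rule real_sqrt_unique) auto
  have "willmore (Complex 0 y) f = (\<integral>\<^sup>+ z. ennreal ((2 * pi * Y (arg z))\<^sup>2) *
      (ennreal (((k (arg z) - 2 * C (arg z)) / (2 * Y (arg z)))\<^sup>2) * indicator (fundamental_parallelogram (Complex 0 y)) z) \<partial>lborel)"
    unfolding willmore_def area_measure_def first_ff_f mean_curvature_f fund
    by (subst nn_integral_density) (simp_all add: inner_complex_def sqrt4)
  also have "\<dots> = (\<integral>\<^sup>+ z. ennreal (h (Im z)) * indicator {z. Re z \<in> {0..<1} \<and> Im z \<in> {0..<y}} z \<partial>lborel)"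
  proof (rule nn_integral_cong)
    fix z
    have "(2 * pi * Y (arg z))\<^sup>2 * ((k (arg z) - 2 * C (arg z)) / (2 * Y (arg z)))\<^sup>2 = h (Im z)"
      using Y_pos[of "arg z"] by (simp add: h_def arg_def power_divide power_mult_distrib)
    then show "ennreal ((2 * pi * Y (arg z))\<^sup>2) * (ennreal (((k (arg z) - 2 * C (arg z)) / (2 * Y (arg z)))\<^sup>2)
        * indicator (fundamental_parallelogram (Complex 0 y)) z)
      = ennreal (h (Im z)) * indicator {z. Re z \<in> {0..<1} \<and> Im z \<in> {0..<y}} z"
      unfolding fund mult.assoc[symmetric] by (simp add: ennreal_mult[symmetric])
  qed
  also have "\<dots> = (\<integral>\<^sup>+ t. ennreal (h t) * indicator {0..<y} t \<partial>lborel)"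
    by (rule nn_integral_complex_box) measurable
  \<comment> \<open>The end point is a null set; adding it gives the closed interval for the
    fundamental theorem of calculus.\<close>
  also have "\<dots> = (\<integral>\<^sup>+ t. ennreal (h t) * indicator {0..y} t \<partial>lborel)"
    using AE_lborel_singleton[of y]
    by (intro nn_integral_cong_AE) (auto elim!: eventually_mono simp: indicator_def)
  also have "\<dots> = ennreal (pi / 2 * (J (2 * pi * y - l) - 4 * N (2 * pi * y - l))
      - pi / 2 * (J (2 * pi * 0 - l) - 4 * N (2 * pi * 0 - l)))"
  proof (rule nn_integral_FTC_Icc[where F = "\<lambda>t. pi / 2 * (J (2 * pi * t - l) - 4 * N (2 * pi * t - l))"])
    fix t
    have "((\<lambda>t. pi / 2 * (J (2 * pi * t - l) - 4 * N (2 * pi * t - l))) has_real_derivative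
        pi / 2 * ((k (2 * pi * t - l))\<^sup>2 * (2 * pi * 1 - 0)
        - 4 * (C (2 * pi * t - l) * (k (2 * pi * t - l) - C (2 * pi * t - l)) * (2 * pi * 1 - 0)))) (at t)"
      by (intro DERIV_cmult DERIV_diff DERIV_chain2[OF J] DERIV_chain2[OF profile_atD(6)[OF profile]]
            DERIV_ident DERIV_const)
    then show "((\<lambda>t. pi / 2 * (J (2 * pi * t - l) - 4 * N (2 * pi * t - l))) has_real_derivative h t) (at t)"
      by (rule DERIV_cong) (simp add: h_def algebra_simps power2_eq_square)
  qed (use y in \<open>simp_all add: h_def\<close>)
  also have "\<dots> = ennreal (pi / 2 * (J (2 * pi * y - l) - J (- l)))"
    using per[of "- l"] by (simp add: algebra_simps)
  finally show ?thesis .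
qed

end

theorem corollary1p5:
  shows "\<exists>y0::real. y0 > 1 \<and> (\<forall>y::real. y \<ge> y0 \<longrightarrow> M31 (Complex 0 y) < ennreal (8 * pi))"
proof -
  obtain l0 :: real where l0: "l0 > 0"
    "\<And>l. l \<ge> l0 \<Longrightarrow> \<exists>X Y C N k J. smooth_curve X \<and> smooth_curve Y \<and> smooth_curve k \<and>
      (\<forall>s. profile_at X Y C N k s \<and> X (s + 4 * l) = X s \<and> Y (s + 4 * l) = Y s \<and>
        N (s + 4 * l) = N s \<and> (J has_real_derivative (k s)\<^sup>2) (at s)) \<and>
      J (3 * l) - J (- l) < 16"
    using closed_profile by blast
  \<comment> \<open>The bound \<open>2 + l0\<close> exceeds one, and \<open>pi / 2 \<ge> 1\<close>
    gives \<open>pi * y / 2 \<ge> l0\<close>.\<close>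
  have "M31 (Complex 0 y) < ennreal (8 * pi)" if y: "y \<ge> 2 + l0" for y
  proof -
    \<comment> \<open>The profile then has length \<open>4 * l = 2 * pi * y\<close>, as the torus
      requires.\<close>
    define l where "l = pi * y / 2"
    have "1 * y \<le> (pi / 2) * y" using y l0(1) pi_ge_two by (intro mult_right_mono) auto
    then have "l \<ge> l0" using y by (simp add: l_def)
    from l0(2)[OF this] obtain X Y C N k J where p: "smooth_curve X" "smooth_curve Y" "smooth_curve k"
      "\<And>s. profile_at X Y C N k s" "\<And>s. X (s + 4 * l) = X s" "\<And>s. Y (s + 4 * l) = Y s"
      "\<And>s. N (s + 4 * l) = N s" "\<And>s. (J has_real_derivative (k s)\<^sup>2) (at s)"
      "J (3 * l) - J (- l) < 16"
      by blast
    have l4: "4 * l = 2 * pi * y" by (simp add: l_def)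
    interpret revolution X Y C N k l using p by unfold_locales auto
    have y0: "y > 0" using y l0(1) by simp
    have "M31 (Complex 0 y) \<le> willmore (Complex 0 y) f"
      unfolding M31_def
      by (rule INF_lower) (use conformal_immersion_f[OF p(5,6)[unfolded l4]] in simp)
    also have "\<dots> = ennreal (pi / 2 * (J (2 * pi * y - l) - J (- l)))"
      by (rule willmore_f[OF smooth_curve_imp_continuous[OF p(3)] y0 p(8) p(7)[unfolded l4]])
    also have "2 * pi * y - l = 3 * l" using l4 by simp
    also have "ennreal (pi / 2 * (J (3 * l) - J (- l))) < ennreal (8 * pi)"
      using mult_strict_left_mono[OF p(9), of "pi / 2"] by (intro ennreal_lessI) auto
    finally show ?thesis .
  qed
  then show ?thesis using l0(1) by (intro exI[of _ "2 + l0"]) auto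
qed

end
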